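(* Let $R$ be a commutative ring, let $\mathcal C$ be a hull class, let $M$ be an $R$-module, and let $s_1,\dots,s_n\in R$ be such that $\operatorname{Supp}_R(M)\subseteq\bigcup_{i=1}^nD(s_i)$. Assume that for each $i$ the localized module $M_{s_i}$ admits a $\mathcal C$-hull $M_{s_i}\hookrightarrow E_i$, but that the family $\{E_i\}_{i=1}^n$ is not patch-compatible on overlaps. Then no global $\mathcal C$-hull $H_{\mathcal C}(M)$ of $M$ can localize to all of the $E_i$; that is, there is no $\mathcal C$-hull $M\hookrightarrow H_{\mathcal C}(M)$ with $H_{\mathcal C}(M)_{s_i}\cong E_i$ over $M_{s_i}$ for all $i$.
   Context: $D(s)=\{\mathfrak p\in\operatorname{Spec} R:s\notin\mathfrak p\}$; $\operatorname{Supp}_R(M)=\{\mathfrak p: M_{\mathfrak p}\neq0\}$; $N_s$ is the localization of $N$ at the powers of $s$, regarded as an $R$-module when membership in $\mathcal C$ is considered. A hull class is a class $\mathcal C$ of $R$-modules closed under isomorphism. A $\mathcal C$-pre-envelope of $M$ is a monomorphism $\iota:M\hookrightarrow H$ with $H\in\mathcal C$ such that every monomorphism $j:M\hookrightarrow E$ with $E\in\mathcal C$ factors as $j=h\circ\iota$ with $h:H\to E$. A $\mathcal C$-hull of $M$ is a $\mathcal C$-pre-envelope $\iota:M\hookrightarrow H$ such that every endomorphism $u$ of $H$ with $u\circ\iota=\iota$ is an automorphism. The family $\{M_{s_i}\hookrightarrow E_i\}$ is patch-compatible if for every pair $i,j$ the localized hulls $(E_i)_{s_j}$ and $(E_j)_{s_i}$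 are isomorphic over $M_{s_is_j}$, i.e. by an isomorphism compatible with the embeddings of $M_{s_is_j}$. *)

theory Defs
  imports "HOL-Algebra.Module" "HOL-Algebra.Ideal"
begin

section \<open>Linear maps\<close>

definition module_hom ::
  "('a, 'r) ring_scheme \<Rightarrow> ('a, 'b) module \<Rightarrow> ('a, 'c) module \<Rightarrow> ('b \<Rightarrow> 'c) set" where
  "module_hom R M N = {f \<in> carrier M \<rightarrow> carrier N.
     (\<forall>x\<in>carrier M. \<forall>y\<in>carrier M. f (x \<oplus>\<^bsub>M\<^esub> y) = f x \<oplus>\<^bsub>N\<^esub> f y) \<and>
     (\<forall>a\<in>carrier R. \<forall>x\<in>carrier M. f (a \<odot>\<^bsub>M\<^esub> x) = a \<odot>\<^bsub>N\<^esub> f x)}"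

definition module_mono ::
  "('a, 'r) ring_scheme \<Rightarrow> ('a, 'b) module \<Rightarrow> ('a, 'c) module \<Rightarrow> ('b \<Rightarrow> 'c) set" where
  "module_mono R M N = {f \<in> module_hom R M N. inj_on f (carrier M)}"

definition module_iso ::
  "('a, 'r) ring_scheme \<Rightarrow> ('a, 'b) module \<Rightarrow> ('a, 'c) module \<Rightarrow> ('b \<Rightarrow> 'c) set" where
  "module_iso R M N = {f \<in> module_hom R M N. bij_betw f (carrier M) (carrier N)}"

definition isomorphic_over ::
  "('a, 'r) ring_scheme \<Rightarrow> ('a, 'b) module \<Rightarrow> ('a, 'c) module \<Rightarrow> ('b \<Rightarrow> 'c)
     \<Rightarrow> ('a, 'd) module \<Rightarrow> ('b \<Rightarrow> 'd) \<Rightarrow> bool" where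
  "isomorphic_over R A L f L' g \<longleftrightarrow>
     (\<exists>h \<in> module_iso R L L'. \<forall>x\<in>carrier A. h (f x) = g x)"


section \<open>Localization of modules\<close>

definition loc_rel ::
  "('a, 'r) ring_scheme \<Rightarrow> 'a set \<Rightarrow> ('a, 'b) module \<Rightarrow> (('b \<times> 'a) \<times> ('b \<times> 'a)) set" where
  "loc_rel R S M = {((x, s), (y, t)). x \<in> carrier M \<and> s \<in> S \<and> y \<in> carrier M \<and> t \<in> S \<and>
     (\<exists>u\<in>S. u \<odot>\<^bsub>M\<^esub> (t \<odot>\<^bsub>M\<^esub> x) = u \<odot>\<^bsub>M\<^esub> (s \<odot>\<^bsub>M\<^esub> y))}"

definition frac ::
  "('a, 'r) ring_scheme \<Rightarrow> 'a set \<Rightarrow> ('a, 'b) module \<Rightarrow> 'b \<Rightarrow> 'a \<Rightarrow> ('b \<times> 'a) set" where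
  "frac R S M x s = loc_rel R S M `` {(x, s)}"

text \<open>\<open>localization R S M\<close> is \<open>S\<^sup>-\<^sup>1M\<close>, for a multiplicative subset \<open>S\<close> of \<open>R\<close>, regarded as an
  \<open>R\<close>-module. The ring fields \<open>mult\<close> and \<open>one\<close> inherited by the record type of modules carry no
  meaning for modules. The unions are taken over representatives of a class: all the sets in such a
  union are equal.\<close>

definition localization ::
  "('a, 'r) ring_scheme \<Rightarrow> 'a set \<Rightarrow> ('a, 'b) module \<Rightarrow> ('a, ('b \<times> 'a) set) module" where
  "localization R S M =
     \<lparr>carrier = (carrier M \<times> S) // loc_rel R S M,
      mult = undefined, one = undefined,
      zero = frac R S M \<zero>\<^bsub>M\<^esub> \<one>\<^bsub>R\<^esub>,
      add = (\<lambda>X Y. \<Union>(x, s)\<in>X. \<Union>(y, t)\<in>Y. frac R S M (t \<odot>\<^bsub>M\<^esub> x \<oplus>\<^bsub>M\<^esub> s \<odot>\<^bsub>M\<^esub> y) (s \<otimes>\<^bsub>R\<^esub> t)),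
      smult = (\<lambda>a X. \<Union>(x, s)\<in>X. frac R S M (a \<odot>\<^bsub>M\<^esub> x) s)\<rparr>"

text \<open>The map \<open>S\<^sup>-\<^sup>1M \<rightarrow> S\<^sup>-\<^sup>1N\<close>, \<open>x/s \<mapsto> f(x)/s\<close>, induced by a linear map \<open>f : M \<rightarrow> N\<close>.\<close>

definition loc_map ::
  "('a, 'r) ring_scheme \<Rightarrow> 'a set \<Rightarrow> ('a, 'c) module \<Rightarrow> ('b \<Rightarrow> 'c)
     \<Rightarrow> ('b \<times> 'a) set \<Rightarrow> ('c \<times> 'a) set" where
  "loc_map R S N f X = (\<Union>(x, s)\<in>X. frac R S N (f x) s)"

definition powers :: "('a, 'r) ring_scheme \<Rightarrow> 'a \<Rightarrow> 'a set" where
  "powers R s = range (\<lambda>k::nat. s [^]\<^bsub>R\<^esub> k)"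

abbreviation localization_at ::
  "('a, 'r) ring_scheme \<Rightarrow> ('a, 'b) module \<Rightarrow> 'a \<Rightarrow> ('a, ('b \<times> 'a) set) module" where
  "localization_at R M s \<equiv> localization R (powers R s) M"

text \<open>The canonical isomorphism \<open>M\<^sub>s\<^sub>t \<rightarrow> (M\<^sub>s)\<^sub>t\<close>, \<open>x/(st)\<^sup>k \<mapsto> (x/s\<^sup>k)/t\<^sup>k\<close>. The union again
  ranges over representatives.\<close>

definition iterated_loc ::
  "('a, 'r) ring_scheme \<Rightarrow> ('a, 'b) module \<Rightarrow> 'a \<Rightarrow> 'a
     \<Rightarrow> ('b \<times> 'a) set \<Rightarrow> (('b \<times> 'a) set \<times> 'a) set" where
  "iterated_loc R M s t X =
     \<Union>{frac R (powers R t) (localization_at R M s)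
          (frac R (powers R s) M x (s [^]\<^bsub>R\<^esub> k)) (t [^]\<^bsub>R\<^esub> k)
        | x (k::nat). (x, (s \<otimes>\<^bsub>R\<^esub> t) [^]\<^bsub>R\<^esub> k) \<in> X}"


section \<open>Spectrum and support\<close>

definition Spec :: "('a, 'r) ring_scheme \<Rightarrow> 'a set set" where
  "Spec R = {p. primeideal p R}"

definition basic_open :: "('a, 'r) ring_scheme \<Rightarrow> 'a \<Rightarrow> 'a set set" where
  "basic_open R s = {p \<in> Spec R. s \<notin> p}"

definition Supp :: "('a, 'r) ring_scheme \<Rightarrow> ('a, 'b) module \<Rightarrow> 'a set set" where
  "Supp R M = {p \<in> Spec R. let Mp = localization R (carrier R - p) M in carrier Mp \<noteq> {\<zero>\<^bsub>Mp\<^esub>}}"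


section \<open>Hulls\<close>

text \<open>The members of a hull class have their carriers in one type \<open>'u\<close>, which is arbitrary and plays
  the role of the universe of sets. A module that is to be embedded in members of the class may
  have its carrier in another type. Hence the localizations, whose elements are sets of pairs, need
  no copy in \<open>'u\<close>.\<close>

definition hull_class :: "('a, 'r) ring_scheme \<Rightarrow> ('a, 'u) module set \<Rightarrow> bool" where
  "hull_class R \<C> \<longleftrightarrow>
     (\<forall>H\<in>\<C>. module R H) \<and>
     (\<forall>H\<in>\<C>. \<forall>H'. module R H' \<longrightarrow> module_iso R H H' \<noteq> {} \<longrightarrow> H' \<in> \<C>)"

definition is_preenvelope ::
  "('a, 'r) ring_scheme \<Rightarrow> ('a, 'u) module set \<Rightarrow> ('a, 'b) module \<Rightarrow> ('a, 'u) module
     \<Rightarrow> ('b \<Rightarrow> 'u) \<Rightarrow> bool" where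
  "is_preenvelope R \<C> M H \<iota> \<longleftrightarrow>
     H \<in> \<C> \<and> \<iota> \<in> module_mono R M H \<and>
     (\<forall>E\<in>\<C>. \<forall>j \<in> module_mono R M E. \<exists>h \<in> module_hom R H E. \<forall>x\<in>carrier M. j x = h (\<iota> x))"

definition is_hull ::
  "('a, 'r) ring_scheme \<Rightarrow> ('a, 'u) module set \<Rightarrow> ('a, 'b) module \<Rightarrow> ('a, 'u) module
     \<Rightarrow> ('b \<Rightarrow> 'u) \<Rightarrow> bool" where
  "is_hull R \<C> M H \<iota> \<longleftrightarrow>
     is_preenvelope R \<C> M H \<iota> \<and>
     (\<forall>u \<in> module_hom R H H. (\<forall>x\<in>carrier M. u (\<iota> x) = \<iota> x) \<longrightarrow> u \<in> module_iso R H H)"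


section \<open>Patch compatibility\<close>

text \<open>For \<open>e : M\<^sub>s \<rightarrow> E\<close>, the map \<open>M\<^sub>s\<^sub>t \<cong> (M\<^sub>s)\<^sub>t \<rightarrow> E\<^sub>t\<close>.\<close>

definition overlap_map ::
  "('a, 'r) ring_scheme \<Rightarrow> ('a, 'b) module \<Rightarrow> 'a \<Rightarrow> 'a \<Rightarrow> ('a, 'u) module
     \<Rightarrow> (('b \<times> 'a) set \<Rightarrow> 'u) \<Rightarrow> ('b \<times> 'a) set \<Rightarrow> ('u \<times> 'a) set" where
  "overlap_map R M s t E e X = loc_map R (powers R t) E e (iterated_loc R M s t X)"

text \<open>The second map below has domain \<open>M\<close> localized at \<open>s\<^sub>js\<^sub>i\<close>, which equals \<open>s\<^sub>is\<^sub>j\<close>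
  because \<open>R\<close> is commutative.\<close>

definition patch_compatible ::
  "('a, 'r) ring_scheme \<Rightarrow> ('a, 'b) module \<Rightarrow> 'i set \<Rightarrow> ('i \<Rightarrow> 'a) \<Rightarrow> ('i \<Rightarrow> ('a, 'u) module)
     \<Rightarrow> ('i \<Rightarrow> ('b \<times> 'a) set \<Rightarrow> 'u) \<Rightarrow> bool" where
  "patch_compatible R M I s E e \<longleftrightarrow>
     (\<forall>i\<in>I. \<forall>j\<in>I. isomorphic_over R (localization_at R M (s i \<otimes>\<^bsub>R\<^esub> s j))
        (localization_at R (E i) (s j)) (overlap_map R M (s i) (s j) (E i) (e i))
        (localization_at R (E j) (s i)) (overlap_map R M (s j) (s i) (E j) (e j)))"

end

theory Submission
  imports Defs
begin

text \<open>
  A global hull would force the local hulls to agree on overlaps, because localization does not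
  depend on the order in which elements are inverted. Suppose \<open>M \<rightarrow> H\<close> localizes to \<open>E\<^sub>i\<close> over
  \<open>M\<^bsub>s\<^sub>i\<^esub>\<close> for all \<open>i\<close>. Then \<open>(E\<^sub>i)\<^bsub>s\<^sub>j\<^esub>\<close> and \<open>(E\<^sub>j)\<^bsub>s\<^sub>i\<^esub>\<close> are both isomorphic to the localization of
  \<open>H\<close> at \<open>s\<^sub>is\<^sub>j\<close>, so they are isomorphic to each other, compatibly with the maps from \<open>M\<close>. This is
  patch-compatibility.

  The iterated localizations consist of equivalence classes of pairs of equivalence classes, and
  comparing them as sets would be laborious. The proof therefore works with a description of
  \<open>H \<rightarrow> H\<^sub>s\<close> up to isomorphism (\<open>is_localization_at\<close>) in terms of the action of \<open>s\<close>. This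
  description is stable under isomorphism of the target, is transitive (a localization at \<open>s\<close>
  followed by one at \<open>t\<close> is a localization at \<open>st\<close>, \<open>is_localization_at_trans\<close>), and determines the
  target uniquely under \<open>H\<close> (\<open>is_localization_at_unique\<close>). It applies to both
  \<open>H \<rightarrow> E\<^sub>i \<rightarrow> (E\<^sub>i)\<^bsub>s\<^sub>j\<^esub>\<close> and \<open>H \<rightarrow> E\<^sub>j \<rightarrow> (E\<^sub>j)\<^bsub>s\<^sub>i\<^esub>\<close>, which gives the isomorphism.

  Compatibility with the maps from \<open>M\<^bsub>s\<^sub>is\<^sub>j\<^esub>\<close> is checked by clearing denominators. The image \<open>z\<close> of
  \<open>x/(s\<^sub>is\<^sub>j)\<^sup>k\<close> is characterized by \<open>(s\<^sub>is\<^sub>j)\<^sup>kz\<close> being the image of \<open>x\<close>, since \<open>s\<^sub>is\<^sub>j\<close> acts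
  bijectively; and a linear map under \<open>H\<close> preserves this equation.
\<close>

section \<open>Linear maps\<close>

lemma module_hom_closed: "f \<in> module_hom R M N \<Longrightarrow> x \<in> carrier M \<Longrightarrow> f x \<in> carrier N"
  by (auto simp: module_hom_def)

lemma module_hom_add:
  "f \<in> module_hom R M N \<Longrightarrow> x \<in> carrier M \<Longrightarrow> y \<in> carrier M \<Longrightarrow> f (x \<oplus>\<^bsub>M\<^esub> y) = f x \<oplus>\<^bsub>N\<^esub> f y"
  by (auto simp: module_hom_def)

lemma module_hom_smult:
  "f \<in> module_hom R M N \<Longrightarrow> a \<in> carrier R \<Longrightarrow> x \<in> carrier M \<Longrightarrow> f (a \<odot>\<^bsub>M\<^esub> x) = a \<odot>\<^bsub>N\<^esub> f x"
  by (auto simp: module_hom_def)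

lemma module_hom_compose:
  assumes "f \<in> module_hom R M N" "g \<in> module_hom R N P"
  shows "(\<lambda>x. g (f x)) \<in> module_hom R M P"
  using assms by (auto simp: module_hom_def Pi_iff)

lemma module_iso_hom: "f \<in> module_iso R M N \<Longrightarrow> f \<in> module_hom R M N"
  by (simp add: module_iso_def)

lemma (in module) smult_left_commute:
  assumes "a \<in> carrier R" "b \<in> carrier R" "x \<in> carrier M"
  shows "a \<odot>\<^bsub>M\<^esub> (b \<odot>\<^bsub>M\<^esub> x) = b \<odot>\<^bsub>M\<^esub> (a \<odot>\<^bsub>M\<^esub> x)"
  using assms by (metis smult_assoc1 m_comm)


section \<open>Modules of fractions\<close>

locale fractions = module R M + denominators: submonoid S R
  for R :: "('a, 'r) ring_scheme" (structure) and M :: "('a, 'b) module" (structure) and S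
begin

lemma denominator_closed: "s \<in> S \<Longrightarrow> s \<in> carrier R"
  using denominators.subset by blast

lemma loc_rel_equiv: "equiv (carrier M \<times> S) (loc_rel R S M)"
proof (rule equivI)
  show "loc_rel R S M \<subseteq> (carrier M \<times> S) \<times> (carrier M \<times> S)"
    by (auto simp: loc_rel_def)
  show "refl_on (carrier M \<times> S) (loc_rel R S M)"
    using denominators.one_closed by (auto simp: refl_on_def loc_rel_def)
  show "sym (loc_rel R S M)"
    by (auto simp: sym_def loc_rel_def) metis
  show "trans (loc_rel R S M)"
  proof (rule transI, clarify)
    fix x s y t z r
    assume "((x, s), (y, t)) \<in> loc_rel R S M" "((y, t), (z, r)) \<in> loc_rel R S M"
    then obtain u v where c: "x \<in> carrier M" "y \<in> carrier M" "z \<in> carrier M"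
      and S: "s \<in> S" "t \<in> S" "r \<in> S" "u \<in> S" "v \<in> S"
      and u: "u \<odot>\<^bsub>M\<^esub> (t \<odot>\<^bsub>M\<^esub> x) = u \<odot>\<^bsub>M\<^esub> (s \<odot>\<^bsub>M\<^esub> y)"
      and v: "v \<odot>\<^bsub>M\<^esub> (r \<odot>\<^bsub>M\<^esub> y) = v \<odot>\<^bsub>M\<^esub> (t \<odot>\<^bsub>M\<^esub> z)"
      by (auto simp: loc_rel_def)
    note R = S[THEN denominator_closed]
    have "(u \<otimes> v \<otimes> t) \<odot>\<^bsub>M\<^esub> (r \<odot>\<^bsub>M\<^esub> x) = v \<odot>\<^bsub>M\<^esub> (r \<odot>\<^bsub>M\<^esub> (u \<odot>\<^bsub>M\<^esub> (t \<odot>\<^bsub>M\<^esub> x)))"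
      using c R by (simp add: smult_assoc1 smult_left_commute)
    also have "\<dots> = u \<odot>\<^bsub>M\<^esub> (s \<odot>\<^bsub>M\<^esub> (v \<odot>\<^bsub>M\<^esub> (r \<odot>\<^bsub>M\<^esub> y)))"
      unfolding u using c R by (simp add: smult_left_commute)
    also have "\<dots> = (u \<otimes> v \<otimes> t) \<odot>\<^bsub>M\<^esub> (s \<odot>\<^bsub>M\<^esub> z)"
      unfolding v using c R by (simp add: smult_assoc1 smult_left_commute)
    finally show "((x, s), (z, r)) \<in> loc_rel R S M"
      using c S unfolding loc_rel_def by (auto intro!: bexI[of _ "u \<otimes> v \<otimes> t"])
  qed
qed

lemma frac_eq_iff:
  assumes "x \<in> carrier M" "s \<in> S" "y \<in> carrier M" "t \<in> S"
  shows "frac R S M x s = frac R S M y t \<longleftrightarrow>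
    (\<exists>u\<in>S. u \<odot>\<^bsub>M\<^esub> (t \<odot>\<^bsub>M\<^esub> x) = u \<odot>\<^bsub>M\<^esub> (s \<odot>\<^bsub>M\<^esub> y))"
  unfolding frac_def using assms
  by (subst eq_equiv_class_iff[OF loc_rel_equiv]) (auto simp: loc_rel_def)

lemma frac_eqI:
  assumes "x \<in> carrier M" "s \<in> S" "y \<in> carrier M" "t \<in> S" "t \<odot>\<^bsub>M\<^esub> x = s \<odot>\<^bsub>M\<^esub> y"
  shows "frac R S M x s = frac R S M y t"
  using assms denominators.one_closed by (subst frac_eq_iff) auto

lemma mem_frac_iff:
  assumes "x \<in> carrier M" "s \<in> S"
  shows "(y, t) \<in> frac R S M x s \<longleftrightarrow> y \<in> carrier M \<and> t \<in> S \<and> frac R S M y t = frac R S M x s"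
proof -
  have "(y, t) \<in> frac R S M x s \<longleftrightarrow> ((x, s), (y, t)) \<in> loc_rel R S M"
    by (simp add: frac_def)
  also have "\<dots> \<longleftrightarrow> y \<in> carrier M \<and> t \<in> S \<and> frac R S M x s = frac R S M y t"
    unfolding loc_rel_def using assms by (simp add: frac_eq_iff cong: conj_cong)
  finally show ?thesis by auto
qed

lemma frac_cancel:
  assumes "x \<in> carrier M" "s \<in> S" "u \<in> S"
  shows "frac R S M (u \<odot>\<^bsub>M\<^esub> x) (u \<otimes> s) = frac R S M x s"
  using assms
  by (intro frac_eqI) (auto simp: denominator_closed smult_assoc1 smult_left_commute)

lemma frac_in_localization:
  "x \<in> carrier M \<Longrightarrow> s \<in> S \<Longrightarrow> frac R S M x s \<in> carrier (localization R S M)"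
  by (auto simp: localization_def frac_def intro: quotientI)

lemma localization_cases:
  assumes "X \<in> carrier (localization R S M)"
  obtains x s where "x \<in> carrier M" "s \<in> S" "X = frac R S M x s"
  using assms by (auto simp: localization_def frac_def elim!: quotientE)

text \<open>The operations on fractions are defined as unions over representatives. This lemma reduces
  the computation of each of them to independence of the representative.\<close>

lemma UN_representatives:
  assumes "x \<in> carrier M" "s \<in> S"
    and "\<And>y t. y \<in> carrier M \<Longrightarrow> t \<in> S \<Longrightarrow> frac R S M y t = frac R S M x s \<Longrightarrow> F y t = F x s"
  shows "(\<Union>(y, t)\<in>frac R S M x s. F y t) = F x s"
proof (rule SUP_eq_const)
  show "frac R S M x s \<noteq> {}"
    using assms(1,2) mem_frac_iff[of x s x s] by blast
next
  fix p assume "p \<in> frac R S M x s"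
  then show "(case p of (y, t) \<Rightarrow> F y t) = F x s"
    using assms(3) mem_frac_iff[OF assms(1,2)] by (cases p) simp
qed

lemma smult_frac:
  assumes a: "a \<in> carrier R" and x: "x \<in> carrier M" and s: "s \<in> S"
  shows "a \<odot>\<^bsub>localization R S M\<^esub> frac R S M x s = frac R S M (a \<odot>\<^bsub>M\<^esub> x) s"
proof -
  have "frac R S M (a \<odot>\<^bsub>M\<^esub> y) t = frac R S M (a \<odot>\<^bsub>M\<^esub> x) s"
    if y: "y \<in> carrier M" and t: "t \<in> S" and eq: "frac R S M y t = frac R S M x s" for y t
  proof -
    obtain u where u: "u \<in> S" "u \<odot>\<^bsub>M\<^esub> (s \<odot>\<^bsub>M\<^esub> y) = u \<odot>\<^bsub>M\<^esub> (t \<odot>\<^bsub>M\<^esub> x)"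
      using eq x y s t by (auto simp: frac_eq_iff)
    have "a \<odot>\<^bsub>M\<^esub> (u \<odot>\<^bsub>M\<^esub> (s \<odot>\<^bsub>M\<^esub> y)) = a \<odot>\<^bsub>M\<^esub> (u \<odot>\<^bsub>M\<^esub> (t \<odot>\<^bsub>M\<^esub> x))"
      using u by simp
    then have "u \<odot>\<^bsub>M\<^esub> (s \<odot>\<^bsub>M\<^esub> (a \<odot>\<^bsub>M\<^esub> y)) = u \<odot>\<^bsub>M\<^esub> (t \<odot>\<^bsub>M\<^esub> (a \<odot>\<^bsub>M\<^esub> x))"
      using a x y s t u by (simp add: denominator_closed smult_left_commute)
    then show ?thesis
      using a x y s t u by (auto simp: frac_eq_iff)
  qed
  then show ?thesis
    using UN_representatives[OF x s, where F = "\<lambda>y t. frac R S M (a \<odot>\<^bsub>M\<^esub> y) t"]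
    by (simp add: localization_def)
qed

lemma add_frac:
  assumes x: "x \<in> carrier M" and s: "s \<in> S" and y: "y \<in> carrier M" and t: "t \<in> S"
  shows "frac R S M x s \<oplus>\<^bsub>localization R S M\<^esub> frac R S M y t =
    frac R S M (t \<odot>\<^bsub>M\<^esub> x \<oplus>\<^bsub>M\<^esub> s \<odot>\<^bsub>M\<^esub> y) (s \<otimes> t)"
proof -
  let ?F = "\<lambda>x s y t. frac R S M (t \<odot>\<^bsub>M\<^esub> x \<oplus>\<^bsub>M\<^esub> s \<odot>\<^bsub>M\<^esub> y) (s \<otimes> t)"
  \<comment> \<open>By symmetry of the formula it suffices to vary the representative of the first summand.\<close>
  have sym: "?F x s y t = ?F y t x s"
    if "x \<in> carrier M" "s \<in> S" "y \<in> carrier M" "t \<in> S" for x s y t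
    using that by (simp add: denominator_closed m_comm M.a_comm)
  have left: "?F x' s' y t = ?F x s y t"
    if x: "x \<in> carrier M" and s: "s \<in> S" and y: "y \<in> carrier M" and t: "t \<in> S"
      and x': "x' \<in> carrier M" and s': "s' \<in> S" and eq: "frac R S M x' s' = frac R S M x s"
    for x s y t x' s'
  proof -
    obtain u where u: "u \<in> S" "u \<odot>\<^bsub>M\<^esub> (s \<odot>\<^bsub>M\<^esub> x') = u \<odot>\<^bsub>M\<^esub> (s' \<odot>\<^bsub>M\<^esub> x)"
      using eq x s x' s' by (auto simp: frac_eq_iff)
    note R = s[THEN denominator_closed] t[THEN denominator_closed]
      s'[THEN denominator_closed] u(1)[THEN denominator_closed]
    have "u \<odot>\<^bsub>M\<^esub> ((s \<otimes> t) \<odot>\<^bsub>M\<^esub> (t \<odot>\<^bsub>M\<^esub> x' \<oplus>\<^bsub>M\<^esub> s' \<odot>\<^bsub>M\<^esub> y)) =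
      t \<odot>\<^bsub>M\<^esub> (t \<odot>\<^bsub>M\<^esub> (u \<odot>\<^bsub>M\<^esub> (s \<odot>\<^bsub>M\<^esub> x'))) \<oplus>\<^bsub>M\<^esub> u \<odot>\<^bsub>M\<^esub> (s \<odot>\<^bsub>M\<^esub> (t \<odot>\<^bsub>M\<^esub> (s' \<odot>\<^bsub>M\<^esub> y)))"
      using R x x' y by (simp add: smult_r_distr smult_assoc1 smult_left_commute)
    also have "\<dots> = u \<odot>\<^bsub>M\<^esub> ((s' \<otimes> t) \<odot>\<^bsub>M\<^esub> (t \<odot>\<^bsub>M\<^esub> x \<oplus>\<^bsub>M\<^esub> s \<odot>\<^bsub>M\<^esub> y))"
      unfolding u(2) using R x x' y by (simp add: smult_r_distr smult_assoc1 smult_left_commute)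
    finally show ?thesis
      using R x x' y s s' t u by (subst frac_eq_iff) auto
  qed
  have inner: "(\<Union>(y', t')\<in>frac R S M y t. ?F x' s' y' t') = ?F x' s' y t"
    if "x' \<in> carrier M" "s' \<in> S" for x' s'
  proof (rule UN_representatives[OF y t])
    fix y' t' assume "y' \<in> carrier M" "t' \<in> S" "frac R S M y' t' = frac R S M y t"
    then show "?F x' s' y' t' = ?F x' s' y t"
      using that y t left[of y t x' s' y' t'] sym[of x' s' y' t'] sym[of x' s' y t] by simp
  qed
  have "(\<Union>(x', s')\<in>frac R S M x s. \<Union>(y', t')\<in>frac R S M y t. ?F x' s' y' t')
    = (\<Union>(y', t')\<in>frac R S M y t. ?F x s y' t')"
  proof (rule UN_representatives[OF x s])
    fix x' s' assume "x' \<in> carrier M" "s' \<in> S" "frac R S M x' s' = frac R S M x s"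
    then show "(\<Union>(y', t')\<in>frac R S M y t. ?F x' s' y' t') =
        (\<Union>(y', t')\<in>frac R S M y t. ?F x s y' t')"
      using inner[of x' s'] inner[OF x s] left[OF x s y t] by simp
  qed
  also have "\<dots> = ?F x s y t"
    by (rule inner[OF x s])
  finally show ?thesis
    by (simp add: localization_def)
qed

lemma add_frac_same_denominator:
  assumes "x \<in> carrier M" "y \<in> carrier M" "s \<in> S"
  shows "frac R S M x s \<oplus>\<^bsub>localization R S M\<^esub> frac R S M y s = frac R S M (x \<oplus>\<^bsub>M\<^esub> y) s"
  using assms frac_cancel[of "x \<oplus>\<^bsub>M\<^esub> y" s s]
  by (simp add: add_frac smult_r_distr[symmetric] denominator_closed)

text \<open>Over a common denominator, addition of fractions is addition of numerators, so the module
  axioms for fractions are those for the numerators.\<close>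

lemma common_denominator:
  assumes "X \<in> carrier (localization R S M)" "Y \<in> carrier (localization R S M)"
  obtains x y s where "x \<in> carrier M" "y \<in> carrier M" "s \<in> S"
    "X = frac R S M x s" "Y = frac R S M y s"
proof -
  obtain x s where x: "x \<in> carrier M" "s \<in> S" "X = frac R S M x s"
    using assms(1) by (rule localization_cases)
  obtain y t where y: "y \<in> carrier M" "t \<in> S" "Y = frac R S M y t"
    using assms(2) by (rule localization_cases)
  have "X = frac R S M (t \<odot>\<^bsub>M\<^esub> x) (t \<otimes> s)" "Y = frac R S M (s \<odot>\<^bsub>M\<^esub> y) (t \<otimes> s)"
    using x y frac_cancel[of x s t] frac_cancel[of y t s]
    by (simp_all add: denominator_closed m_comm)
  then show ?thesis
    using x y by (intro that[of "t \<odot>\<^bsub>M\<^esub> x" "s \<odot>\<^bsub>M\<^esub> y" "t \<otimes> s"])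
      (auto simp: denominator_closed)
qed

lemma zero_localization:
  assumes "s \<in> S"
  shows "\<zero>\<^bsub>localization R S M\<^esub> = frac R S M \<zero>\<^bsub>M\<^esub> s"
proof -
  have "frac R S M \<zero>\<^bsub>M\<^esub> \<one> = frac R S M \<zero>\<^bsub>M\<^esub> s"
    using assms denominators.one_closed by (intro frac_eqI) (auto simp: denominator_closed)
  then show ?thesis
    by (simp add: localization_def)
qed

lemma module_localization: "module R (localization R S M)"
proof (rule moduleI)
  let ?L = "localization R S M"
  note closed = denominator_closed frac_in_localization smult_frac add_frac_same_denominator
  show "cring R" by (rule is_cring)
  show "abelian_group ?L"
  proof (rule abelian_groupI)
    show "X \<oplus>\<^bsub>?L\<^esub> Y \<in> carrier ?L" if "X \<in> carrier ?L" "Y \<in> carrier ?L" for X Y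
      by (rule common_denominator[OF that]) (simp add: closed)
    show "\<zero>\<^bsub>?L\<^esub> \<in> carrier ?L"
      using denominators.one_closed by (simp add: zero_localization[of \<one>] closed)
    show "X \<oplus>\<^bsub>?L\<^esub> Y = Y \<oplus>\<^bsub>?L\<^esub> X" if "X \<in> carrier ?L" "Y \<in> carrier ?L" for X Y
      by (rule common_denominator[OF that]) (simp add: closed M.a_comm)
    show "\<zero>\<^bsub>?L\<^esub> \<oplus>\<^bsub>?L\<^esub> X = X" if "X \<in> carrier ?L" for X
      using that by (elim localization_cases) (simp add: zero_localization closed)
    show "\<exists>Y\<in>carrier ?L. Y \<oplus>\<^bsub>?L\<^esub> X = \<zero>\<^bsub>?L\<^esub>" if X: "X \<in> carrier ?L" for X
    proof -
      obtain x s where "x \<in> carrier M" "s \<in> S" "X = frac R S M x s"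
        using X by (rule localization_cases)
      then show ?thesis
        by (intro bexI[of _ "frac R S M (\<ominus>\<^bsub>M\<^esub> x) s"])
          (auto simp: closed zero_localization[of s] M.l_neg)
    qed
    show "X \<oplus>\<^bsub>?L\<^esub> Y \<oplus>\<^bsub>?L\<^esub> Z = X \<oplus>\<^bsub>?L\<^esub> (Y \<oplus>\<^bsub>?L\<^esub> Z)"
      if XYZ: "X \<in> carrier ?L" "Y \<in> carrier ?L" "Z \<in> carrier ?L" for X Y Z
    proof -
      obtain x y s where xy: "x \<in> carrier M" "y \<in> carrier M" "s \<in> S"
        "X = frac R S M x s" "Y = frac R S M y s"
        using XYZ(1,2) by (rule common_denominator)
      obtain z t where z: "z \<in> carrier M" "t \<in> S" "Z = frac R S M z t"
        using XYZ(3) by (rule localization_cases)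
      have "X = frac R S M (t \<odot>\<^bsub>M\<^esub> x) (t \<otimes> s)" "Y = frac R S M (t \<odot>\<^bsub>M\<^esub> y) (t \<otimes> s)"
        "Z = frac R S M (s \<odot>\<^bsub>M\<^esub> z) (t \<otimes> s)"
        using xy z frac_cancel[of x s t] frac_cancel[of y s t] frac_cancel[of z t s]
        by (simp_all add: denominator_closed m_comm)
      then show ?thesis
        using xy z by (simp add: closed M.a_assoc)
    qed
  qed
  show "a \<odot>\<^bsub>?L\<^esub> X \<in> carrier ?L" if "a \<in> carrier R" "X \<in> carrier ?L" for a X
    using that by (elim localization_cases) (simp add: closed)
  show "(a \<oplus> b) \<odot>\<^bsub>?L\<^esub> X = a \<odot>\<^bsub>?L\<^esub> X \<oplus>\<^bsub>?L\<^esub> b \<odot>\<^bsub>?L\<^esub> X"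
    if "a \<in> carrier R" "b \<in> carrier R" "X \<in> carrier ?L" for a b X
    using that by (elim localization_cases) (simp add: closed smult_l_distr)
  show "a \<odot>\<^bsub>?L\<^esub> (X \<oplus>\<^bsub>?L\<^esub> Y) = a \<odot>\<^bsub>?L\<^esub> X \<oplus>\<^bsub>?L\<^esub> a \<odot>\<^bsub>?L\<^esub> Y"
    if "a \<in> carrier R" "X \<in> carrier ?L" "Y \<in> carrier ?L" for a X Y
    by (rule common_denominator[OF that(2,3)]) (simp add: that(1) closed smult_r_distr)
  show "(a \<otimes> b) \<odot>\<^bsub>?L\<^esub> X = a \<odot>\<^bsub>?L\<^esub> (b \<odot>\<^bsub>?L\<^esub> X)"
    if "a \<in> carrier R" "b \<in> carrier R" "X \<in> carrier ?L" for a b X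
    using that by (elim localization_cases) (simp add: closed smult_assoc1)
  show "\<one> \<odot>\<^bsub>?L\<^esub> X = X" if "X \<in> carrier ?L" for X
    using that by (elim localization_cases) (simp add: closed)
qed

lemma smult_denominator_frac:
  assumes "x \<in> carrier M" "s \<in> S" "t \<in> S"
  shows "s \<odot>\<^bsub>localization R S M\<^esub> frac R S M x (s \<otimes> t) = frac R S M x t"
  using assms by (simp add: smult_frac denominator_closed frac_cancel)

lemma canonical_map_hom: "(\<lambda>x. frac R S M x \<one>) \<in> module_hom R M (localization R S M)"
  using denominators.one_closed
  by (auto simp: module_hom_def frac_in_localization smult_frac add_frac_same_denominator)

lemma loc_map_frac:
  assumes N: "fractions R N S" and f: "f \<in> module_hom R M N"
    and x: "x \<in> carrier M" and s: "s \<in> S"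
  shows "loc_map R S N f (frac R S M x s) = frac R S N (f x) s"
  unfolding loc_map_def
proof (rule UN_representatives[OF x s])
  interpret N: fractions R N S by (rule N)
  fix y t assume y: "y \<in> carrier M" and t: "t \<in> S" and "frac R S M y t = frac R S M x s"
  then obtain u where u: "u \<in> S" "u \<odot>\<^bsub>M\<^esub> (s \<odot>\<^bsub>M\<^esub> y) = u \<odot>\<^bsub>M\<^esub> (t \<odot>\<^bsub>M\<^esub> x)"
    using x s by (auto simp: frac_eq_iff)
  have "u \<odot>\<^bsub>N\<^esub> (s \<odot>\<^bsub>N\<^esub> f y) = f (u \<odot>\<^bsub>M\<^esub> (s \<odot>\<^bsub>M\<^esub> y))"
    using s u(1) y by (simp add: module_hom_smult[OF f] denominator_closed)
  also have "\<dots> = u \<odot>\<^bsub>N\<^esub> (t \<odot>\<^bsub>N\<^esub> f x)"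
    unfolding u(2) using t u(1) x by (simp add: module_hom_smult[OF f] denominator_closed)
  finally show "frac R S N (f y) t = frac R S N (f x) s"
    using s t u x y by (subst N.frac_eq_iff) (auto simp: module_hom_closed[OF f])
qed

end


section \<open>Localization at one element, characterized by its action\<close>

lemma (in cring) submonoid_powers:
  assumes "s \<in> carrier R"
  shows "submonoid (powers R s) R"
proof
  show "powers R s \<subseteq> carrier R"
    using assms by (auto simp: powers_def)
  show "x \<otimes> y \<in> powers R s" if "x \<in> powers R s" "y \<in> powers R s" for x y
    using that assms by (auto simp: powers_def nat_pow_mult)
  show "\<one> \<in> powers R s"
    unfolding powers_def by (rule range_eqI[of _ _ 0]) simp
qed

lemma fractions_powers:
  assumes "module R M" "s \<in> carrier R"
  shows "fractions R M (powers R s)"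
  using assms by (intro fractions.intro cring.submonoid_powers) (auto simp: module_def)

lemma pow_in_powers: "s [^]\<^bsub>R\<^esub> (k::nat) \<in> powers R s"
  by (simp add: powers_def)

text \<open>Up to isomorphism under \<open>M\<close>, this is the canonical map \<open>M \<rightarrow> M\<^sub>s\<close>: \<open>s\<close> becomes invertible, every
  element is a fraction \<open>\<phi>(x)/s\<^sup>k\<close>, and only elements killed by a power of \<open>s\<close> vanish. The last
  condition is stated for pairs of elements, in the shape of equality of fractions.\<close>

definition is_localization_at ::
  "('a, 'r) ring_scheme \<Rightarrow> 'a \<Rightarrow> ('a, 'b) module \<Rightarrow> ('a, 'c) module \<Rightarrow> ('b \<Rightarrow> 'c) \<Rightarrow> bool" where
  "is_localization_at R s M L \<phi> \<longleftrightarrow>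
     \<phi> \<in> module_hom R M L \<and>
     bij_betw (\<lambda>y. s \<odot>\<^bsub>L\<^esub> y) (carrier L) (carrier L) \<and>
     (\<forall>y\<in>carrier L. \<exists>k::nat. \<exists>x\<in>carrier M. s [^]\<^bsub>R\<^esub> k \<odot>\<^bsub>L\<^esub> y = \<phi> x) \<and>
     (\<forall>x\<in>carrier M. \<forall>x'\<in>carrier M. \<phi> x = \<phi> x' \<longrightarrow>
        (\<exists>k::nat. s [^]\<^bsub>R\<^esub> k \<odot>\<^bsub>M\<^esub> x = s [^]\<^bsub>R\<^esub> k \<odot>\<^bsub>M\<^esub> x'))"

lemma is_localization_at_eqD:
  assumes "is_localization_at R s M L \<phi>" "x \<in> carrier M" "x' \<in> carrier M" "\<phi> x = \<phi> x'"
  obtains k :: nat where "s [^]\<^bsub>R\<^esub> k \<odot>\<^bsub>M\<^esub> x = s [^]\<^bsub>R\<^esub> k \<odot>\<^bsub>M\<^esub> x'"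
  using assms unfolding is_localization_at_def by blast

lemma (in module) bij_betw_smultI:
  assumes "s \<in> carrier R"
    and "\<And>x y. x \<in> carrier M \<Longrightarrow> y \<in> carrier M \<Longrightarrow> s \<odot>\<^bsub>M\<^esub> x = s \<odot>\<^bsub>M\<^esub> y \<Longrightarrow> x = y"
    and "\<And>x. x \<in> carrier M \<Longrightarrow> \<exists>y\<in>carrier M. x = s \<odot>\<^bsub>M\<^esub> y"
  shows "bij_betw (\<lambda>y. s \<odot>\<^bsub>M\<^esub> y) (carrier M) (carrier M)"
proof (rule bij_betw_imageI)
  show "inj_on (\<lambda>y. s \<odot>\<^bsub>M\<^esub> y) (carrier M)"
    using assms(2) by (rule inj_onI)
  show "(\<lambda>y. s \<odot>\<^bsub>M\<^esub> y) ` carrier M = carrier M"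
    using assms(1,3) by (fastforce simp: image_iff)
qed

lemma (in module) bij_betw_smult_pow:
  assumes "s \<in> carrier R" "bij_betw (\<lambda>y. s \<odot>\<^bsub>M\<^esub> y) (carrier M) (carrier M)"
  shows "bij_betw (\<lambda>y. s [^] (k::nat) \<odot>\<^bsub>M\<^esub> y) (carrier M) (carrier M)"
proof (induction k)
  case 0
  have "bij_betw (\<lambda>y. y) (carrier M) (carrier M)"
    using bij_betw_id by (simp add: id_def)
  then show ?case
    by (subst bij_betw_cong[where g = "\<lambda>y. y"]) auto
next
  case (Suc k)
  have "bij_betw (\<lambda>y. s [^] k \<odot>\<^bsub>M\<^esub> (s \<odot>\<^bsub>M\<^esub> y)) (carrier M) (carrier M)"
    using bij_betw_trans[OF assms(2) Suc.IH] by (simp add: comp_def)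
  then show ?case
    using assms(1) by (subst bij_betw_cong[where g = "\<lambda>y. s [^] k \<odot>\<^bsub>M\<^esub> (s \<odot>\<^bsub>M\<^esub> y)"])
      (auto simp: smult_assoc1)
qed

lemma (in module) smult_pow_cancel:
  assumes "s \<in> carrier R" "bij_betw (\<lambda>y. s \<odot>\<^bsub>M\<^esub> y) (carrier M) (carrier M)"
    and "x \<in> carrier M" "y \<in> carrier M" "s [^] (k::nat) \<odot>\<^bsub>M\<^esub> x = s [^] k \<odot>\<^bsub>M\<^esub> y"
  shows "x = y"
  using bij_betw_smult_pow[OF assms(1,2), of k] assms(3-5)
  by (auto simp: bij_betw_def inj_on_def)

lemma (in module) smult_pow_add:
  assumes "s \<in> carrier R" "x \<in> carrier M"
  shows "s [^] (k + l :: nat) \<odot>\<^bsub>M\<^esub> x = s [^] k \<odot>\<^bsub>M\<^esub> (s [^] l \<odot>\<^bsub>M\<^esub> x)"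
  using assms by (simp add: nat_pow_mult[symmetric] smult_assoc1)

lemma (in module) smult_pow_mult:
  assumes "s \<in> carrier R" "t \<in> carrier R" "x \<in> carrier M"
  shows "(s \<otimes> t) [^] (k::nat) \<odot>\<^bsub>M\<^esub> x = s [^] k \<odot>\<^bsub>M\<^esub> (t [^] k \<odot>\<^bsub>M\<^esub> x)"
  using assms by (simp add: pow_mult_distrib[OF m_comm] smult_assoc1)

lemma localization_at_is_localization_at:
  fixes R (structure)
  assumes M: "module R M" and s: "s \<in> carrier R"
  shows "is_localization_at R s M (localization_at R M s) (\<lambda>x. frac R (powers R s) M x \<one>)"
proof -
  interpret fractions R M "powers R s"
    by (rule fractions_powers[OF M s])
  let ?L = "localization_at R M s" and ?f = "frac R (powers R s) M"
  interpret L: module R ?L by (rule module_localization)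
  have s': "s \<in> powers R s"
    using pow_in_powers[of R s 1] s by simp
  have inj: "X = Y"
    if XY: "X \<in> carrier ?L" "Y \<in> carrier ?L" and eq: "s \<odot>\<^bsub>?L\<^esub> X = s \<odot>\<^bsub>?L\<^esub> Y" for X Y
  proof -
    obtain x y t where xy: "x \<in> carrier M" "y \<in> carrier M" "t \<in> powers R s" "X = ?f x t" "Y = ?f y t"
      using XY by (rule common_denominator)
    have t: "t \<in> carrier R" using xy(3) by (rule denominator_closed)
    have "?f (s \<odot>\<^bsub>M\<^esub> x) t = ?f (s \<odot>\<^bsub>M\<^esub> y) t"
      using eq xy s by (simp add: smult_frac)
    then obtain u where u: "u \<in> powers R s"
      "u \<odot>\<^bsub>M\<^esub> (t \<odot>\<^bsub>M\<^esub> (s \<odot>\<^bsub>M\<^esub> x)) = u \<odot>\<^bsub>M\<^esub> (t \<odot>\<^bsub>M\<^esub> (s \<odot>\<^bsub>M\<^esub> y))"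
      using xy s by (auto simp: frac_eq_iff)
    have "(u \<otimes> s) \<odot>\<^bsub>M\<^esub> (t \<odot>\<^bsub>M\<^esub> x) = (u \<otimes> s) \<odot>\<^bsub>M\<^esub> (t \<odot>\<^bsub>M\<^esub> y)"
      using u xy t s by (simp add: smult_assoc1 denominator_closed smult_left_commute[of s t])
    then have "\<exists>v\<in>powers R s. v \<odot>\<^bsub>M\<^esub> (t \<odot>\<^bsub>M\<^esub> x) = v \<odot>\<^bsub>M\<^esub> (t \<odot>\<^bsub>M\<^esub> y)"
      using u(1) s' by blast
    then show ?thesis
      using xy by (simp add: frac_eq_iff)
  qed
  have surj: "\<exists>Y\<in>carrier ?L. X = s \<odot>\<^bsub>?L\<^esub> Y" if "X \<in> carrier ?L" for X
  proof -
    obtain x t where x: "x \<in> carrier M" "t \<in> powers R s" "X = ?f x t"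
      using \<open>X \<in> carrier ?L\<close> by (rule localization_cases)
    then show ?thesis
      using s' by (intro bexI[of _ "?f x (s \<otimes> t)"])
        (auto simp: smult_denominator_frac frac_in_localization)
  qed
  have "bij_betw (\<lambda>y. s \<odot>\<^bsub>?L\<^esub> y) (carrier ?L) (carrier ?L)"
    using s inj surj by (rule L.bij_betw_smultI)
  moreover have "\<exists>k::nat. \<exists>x\<in>carrier M. s [^] k \<odot>\<^bsub>?L\<^esub> X = ?f x \<one>" if "X \<in> carrier ?L" for X
  proof -
    obtain x t where x: "x \<in> carrier M" "t \<in> powers R s" "X = ?f x t"
      using \<open>X \<in> carrier ?L\<close> by (rule localization_cases)
    then obtain k :: nat where "t = s [^] k"
      by (auto simp: powers_def)
    then have "s [^] k \<odot>\<^bsub>?L\<^esub> X = ?f x \<one>"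
      using x s smult_denominator_frac[of x t \<one>] denominators.one_closed by simp
    then show ?thesis using x by blast
  qed
  moreover have "\<exists>k::nat. s [^] k \<odot>\<^bsub>M\<^esub> x = s [^] k \<odot>\<^bsub>M\<^esub> y"
    if xy: "x \<in> carrier M" "y \<in> carrier M" "?f x \<one> = ?f y \<one>" for x y
  proof -
    obtain u where "u \<in> powers R s" "u \<odot>\<^bsub>M\<^esub> x = u \<odot>\<^bsub>M\<^esub> y"
      using xy denominators.one_closed by (auto simp: frac_eq_iff)
    then show ?thesis
      by (auto simp: powers_def)
  qed
  ultimately show ?thesis
    unfolding is_localization_at_def using canonical_map_hom by blast
qed

lemma is_localization_at_compose_iso:
  assumes loc: "is_localization_at R s M L \<phi>" and h: "h \<in> module_iso R L L'"
    and L: "module R L" and s: "s \<in> carrier R"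
  shows "is_localization_at R s M L' (\<lambda>x. h (\<phi> x))"
proof -
  interpret L: module R L by (rule L)
  have \<phi>: "\<phi> \<in> module_hom R M L" and bij: "bij_betw (\<lambda>y. s \<odot>\<^bsub>L\<^esub> y) (carrier L) (carrier L)"
    using loc by (auto simp: is_localization_at_def)
  have hom: "h \<in> module_hom R L L'" and hbij: "bij_betw h (carrier L) (carrier L')"
    using h by (auto simp: module_iso_def)
  have "bij_betw (\<lambda>y. h (s \<odot>\<^bsub>L\<^esub> y)) (carrier L) (carrier L')"
    using bij_betw_trans[OF bij hbij] by (simp add: comp_def)
  then have "bij_betw ((\<lambda>y. s \<odot>\<^bsub>L'\<^esub> y) \<circ> h) (carrier L) (carrier L')"
    by (rule bij_betw_cong[THEN iffD1, rotated]) (simp add: module_hom_smult[OF hom] s)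
  then have "bij_betw (\<lambda>y. s \<odot>\<^bsub>L'\<^esub> y) (carrier L') (carrier L')"
    using bij_betw_comp_iff[OF hbij] by blast
  moreover have "\<exists>k::nat. \<exists>x\<in>carrier M. s [^]\<^bsub>R\<^esub> k \<odot>\<^bsub>L'\<^esub> z = h (\<phi> x)" if z: "z \<in> carrier L'" for z
  proof -
    obtain y where y: "y \<in> carrier L" "z = h y"
      using z hbij by (auto simp: bij_betw_def)
    then obtain k :: nat and x where "x \<in> carrier M" "s [^]\<^bsub>R\<^esub> k \<odot>\<^bsub>L\<^esub> y = \<phi> x"
      using loc by (auto simp: is_localization_at_def)
    then show ?thesis
      using y s module_hom_smult[OF hom, of "s [^]\<^bsub>R\<^esub> k" y] by (metis L.nat_pow_closed)
  qed
  moreover have "\<exists>k::nat. s [^]\<^bsub>R\<^esub> k \<odot>\<^bsub>M\<^esub> x = s [^]\<^bsub>R\<^esub> k \<odot>\<^bsub>M\<^esub> x'"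
    if "x \<in> carrier M" "x' \<in> carrier M" "h (\<phi> x) = h (\<phi> x')" for x x'
    using that loc module_hom_closed[OF \<phi>] hbij
    by (auto simp: is_localization_at_def bij_betw_def inj_on_def)
  ultimately show ?thesis
    unfolding is_localization_at_def using module_hom_compose[OF \<phi> hom] by blast
qed

text \<open>The point is that \<open>s\<close>, which is invertible on \<open>L\<close>, remains so on the localization \<open>L'\<close> of
  \<open>L\<close> at \<open>t\<close>: every element of \<open>L'\<close> becomes an image from \<open>L\<close> after multiplication by a power of
  \<open>t\<close>, and the two actions commute. A product \<open>s\<^sup>lt\<^sup>k\<close> that clears
  denominators or kills an element divides \<open>(st)\<^sup>k\<^sup>+\<^sup>l\<close>, so a power of \<open>st\<close> does the same.\<close>

lemma is_localization_at_trans: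
  assumes loc: "is_localization_at R s M L \<phi>" and loc': "is_localization_at R t L L' \<psi>"
    and M: "module R M" and L: "module R L" and L': "module R L'"
    and s: "s \<in> carrier R" and t: "t \<in> carrier R"
  shows "is_localization_at R (s \<otimes>\<^bsub>R\<^esub> t) M L' (\<lambda>x. \<psi> (\<phi> x))"
proof -
  interpret M: module R M by (rule M)
  interpret L: module R L by (rule L)
  interpret L': module R L' by (rule L')
  have \<phi>: "\<phi> \<in> module_hom R M L" and bij: "bij_betw (\<lambda>y. s \<odot>\<^bsub>L\<^esub> y) (carrier L) (carrier L)"
    using loc by (auto simp: is_localization_at_def)
  have \<psi>: "\<psi> \<in> module_hom R L L'"
    and bij': "bij_betw (\<lambda>y. t \<odot>\<^bsub>L'\<^esub> y) (carrier L') (carrier L')"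
    using loc' by (auto simp: is_localization_at_def)
  note closed = module_hom_closed[OF \<phi>] module_hom_closed[OF \<psi>]
  note lin = module_hom_smult[OF \<phi>] module_hom_smult[OF \<psi>]
  have numerator: "\<exists>k::nat. \<exists>y\<in>carrier L. t [^]\<^bsub>R\<^esub> k \<odot>\<^bsub>L'\<^esub> z = \<psi> y" if "z \<in> carrier L'" for z
    using that loc' by (auto simp: is_localization_at_def)
  have inj: "z = z'"
    if z: "z \<in> carrier L'" "z' \<in> carrier L'" and eq: "s \<odot>\<^bsub>L'\<^esub> z = s \<odot>\<^bsub>L'\<^esub> z'" for z z'
  proof -
    obtain k l :: nat and y0 y0' where y0: "y0 \<in> carrier L" "t [^]\<^bsub>R\<^esub> k \<odot>\<^bsub>L'\<^esub> z = \<psi> y0"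
      "y0' \<in> carrier L" "t [^]\<^bsub>R\<^esub> l \<odot>\<^bsub>L'\<^esub> z' = \<psi> y0'"
      using numerator z by meson
    \<comment> \<open>Numerators of \<open>z\<close> and \<open>z'\<close> over the common denominator \<open>t\<^sup>k\<^sup>+\<^sup>l\<close>.\<close>
    define y where "y = t [^]\<^bsub>R\<^esub> l \<odot>\<^bsub>L\<^esub> y0"
    define y' where "y' = t [^]\<^bsub>R\<^esub> k \<odot>\<^bsub>L\<^esub> y0'"
    have y: "y \<in> carrier L" "y' \<in> carrier L"
      using y0 t by (auto simp: y_def y'_def)
    have ty: "\<psi> y = t [^]\<^bsub>R\<^esub> (k + l) \<odot>\<^bsub>L'\<^esub> z" "\<psi> y' = t [^]\<^bsub>R\<^esub> (k + l) \<odot>\<^bsub>L'\<^esub> z'"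
      using y0 t z
      by (simp_all add: y_def y'_def lin L'.smult_pow_add L'.smult_left_commute flip: y0(2,4))
    have "\<psi> (s \<odot>\<^bsub>L\<^esub> y) = t [^]\<^bsub>R\<^esub> (k + l) \<odot>\<^bsub>L'\<^esub> (s \<odot>\<^bsub>L'\<^esub> z)"
      using y s t z by (simp add: lin ty L'.smult_left_commute)
    also have "\<dots> = \<psi> (s \<odot>\<^bsub>L\<^esub> y')"
      unfolding eq using y s t z by (simp add: lin ty L'.smult_left_commute)
    finally obtain m :: nat
      where "t [^]\<^bsub>R\<^esub> m \<odot>\<^bsub>L\<^esub> (s \<odot>\<^bsub>L\<^esub> y) = t [^]\<^bsub>R\<^esub> m \<odot>\<^bsub>L\<^esub> (s \<odot>\<^bsub>L\<^esub> y')"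
      using y s by (auto elim: is_localization_at_eqD[OF loc', rotated 2])
    then have "s \<odot>\<^bsub>L\<^esub> (t [^]\<^bsub>R\<^esub> m \<odot>\<^bsub>L\<^esub> y) = s \<odot>\<^bsub>L\<^esub> (t [^]\<^bsub>R\<^esub> m \<odot>\<^bsub>L\<^esub> y')"
      using y s t by (simp add: L.smult_left_commute)
    then have "t [^]\<^bsub>R\<^esub> m \<odot>\<^bsub>L\<^esub> y = t [^]\<^bsub>R\<^esub> m \<odot>\<^bsub>L\<^esub> y'"
      using bij y t by (auto simp: bij_betw_def inj_on_def)
    then have "t [^]\<^bsub>R\<^esub> m \<odot>\<^bsub>L'\<^esub> \<psi> y = t [^]\<^bsub>R\<^esub> m \<odot>\<^bsub>L'\<^esub> \<psi> y'"
      using y t by (metis lin(2) M.nat_pow_closed)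
    then have "\<psi> y = \<psi> y'"
      using L'.smult_pow_cancel[OF t bij'] y closed by blast
    then show ?thesis
      unfolding ty using L'.smult_pow_cancel[OF t bij'] z by blast
  qed
  have surj: "\<exists>w\<in>carrier L'. z = s \<odot>\<^bsub>L'\<^esub> w" if z: "z \<in> carrier L'" for z
  proof -
    obtain k :: nat and y where y: "y \<in> carrier L" "t [^]\<^bsub>R\<^esub> k \<odot>\<^bsub>L'\<^esub> z = \<psi> y"
      using numerator z by blast
    obtain y' where y': "y' \<in> carrier L" "y = s \<odot>\<^bsub>L\<^esub> y'"
      using y bij by (auto simp: bij_betw_def)
    obtain w where w: "w \<in> carrier L'" "t [^]\<^bsub>R\<^esub> k \<odot>\<^bsub>L'\<^esub> w = \<psi> y'"
      using L'.bij_betw_smult_pow[OF t bij', of k] closed(2)[OF y'(1)]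
      by (auto simp: bij_betw_def) (metis imageE)
    have "t [^]\<^bsub>R\<^esub> k \<odot>\<^bsub>L'\<^esub> z = t [^]\<^bsub>R\<^esub> k \<odot>\<^bsub>L'\<^esub> (s \<odot>\<^bsub>L'\<^esub> w)"
      using w y y' s t by (simp add: lin L'.smult_left_commute[of _ s])
    then have "z = s \<odot>\<^bsub>L'\<^esub> w"
      by (rule L'.smult_pow_cancel[OF t bij' z L'.smult_closed[OF s w(1)]])
    then show ?thesis using w by blast
  qed
  have "bij_betw (\<lambda>y. s \<odot>\<^bsub>L'\<^esub> y) (carrier L') (carrier L')"
    using s inj surj by (rule L'.bij_betw_smultI)
  then have "bij_betw (\<lambda>y. s \<odot>\<^bsub>L'\<^esub> (t \<odot>\<^bsub>L'\<^esub> y)) (carrier L') (carrier L')"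
    using bij_betw_trans[OF bij'] by (simp add: comp_def)
  then have "bij_betw (\<lambda>y. (s \<otimes>\<^bsub>R\<^esub> t) \<odot>\<^bsub>L'\<^esub> y) (carrier L') (carrier L')"
    by (rule bij_betw_cong[THEN iffD1, rotated]) (simp add: s t L'.smult_assoc1)
  moreover have "\<exists>k::nat. \<exists>x\<in>carrier M. (s \<otimes>\<^bsub>R\<^esub> t) [^]\<^bsub>R\<^esub> k \<odot>\<^bsub>L'\<^esub> z = \<psi> (\<phi> x)"
    if z: "z \<in> carrier L'" for z
  proof -
    obtain k :: nat and y where y: "y \<in> carrier L" "t [^]\<^bsub>R\<^esub> k \<odot>\<^bsub>L'\<^esub> z = \<psi> y"
      using numerator z by blast
    obtain l :: nat and x where x: "x \<in> carrier M" "s [^]\<^bsub>R\<^esub> l \<odot>\<^bsub>L\<^esub> y = \<phi> x"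
      using loc y by (auto simp: is_localization_at_def)
    have "(s \<otimes>\<^bsub>R\<^esub> t) [^]\<^bsub>R\<^esub> (k + l) \<odot>\<^bsub>L'\<^esub> z =
      s [^]\<^bsub>R\<^esub> k \<odot>\<^bsub>L'\<^esub> (t [^]\<^bsub>R\<^esub> l \<odot>\<^bsub>L'\<^esub> (s [^]\<^bsub>R\<^esub> l \<odot>\<^bsub>L'\<^esub> (t [^]\<^bsub>R\<^esub> k \<odot>\<^bsub>L'\<^esub> z)))"
      using s t z by (simp add: L'.smult_pow_mult L'.smult_pow_add L'.smult_left_commute)
    also have "\<dots> = \<psi> (\<phi> (s [^]\<^bsub>R\<^esub> k \<odot>\<^bsub>M\<^esub> (t [^]\<^bsub>R\<^esub> l \<odot>\<^bsub>M\<^esub> x)))"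
      using s t x y closed by (simp add: lin flip: x(2))
    finally show ?thesis
      using x s t by blast
  qed
  moreover have "\<exists>k::nat. (s \<otimes>\<^bsub>R\<^esub> t) [^]\<^bsub>R\<^esub> k \<odot>\<^bsub>M\<^esub> x = (s \<otimes>\<^bsub>R\<^esub> t) [^]\<^bsub>R\<^esub> k \<odot>\<^bsub>M\<^esub> x'"
    if x: "x \<in> carrier M" "x' \<in> carrier M" and eq: "\<psi> (\<phi> x) = \<psi> (\<phi> x')" for x x'
  proof -
    obtain k :: nat where "t [^]\<^bsub>R\<^esub> k \<odot>\<^bsub>L\<^esub> \<phi> x = t [^]\<^bsub>R\<^esub> k \<odot>\<^bsub>L\<^esub> \<phi> x'"
      using x eq closed by (auto elim: is_localization_at_eqD[OF loc', rotated 2])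
    then have "\<phi> (t [^]\<^bsub>R\<^esub> k \<odot>\<^bsub>M\<^esub> x) = \<phi> (t [^]\<^bsub>R\<^esub> k \<odot>\<^bsub>M\<^esub> x')"
      using x t by (simp add: lin)
    then obtain l :: nat where l: "s [^]\<^bsub>R\<^esub> l \<odot>\<^bsub>M\<^esub> (t [^]\<^bsub>R\<^esub> k \<odot>\<^bsub>M\<^esub> x) =
      s [^]\<^bsub>R\<^esub> l \<odot>\<^bsub>M\<^esub> (t [^]\<^bsub>R\<^esub> k \<odot>\<^bsub>M\<^esub> x')"
      using x t by (auto elim: is_localization_at_eqD[OF loc, rotated 2])
    have "(s \<otimes>\<^bsub>R\<^esub> t) [^]\<^bsub>R\<^esub> (k + l) \<odot>\<^bsub>M\<^esub> v =
      s [^]\<^bsub>R\<^esub> k \<odot>\<^bsub>M\<^esub> (t [^]\<^bsub>R\<^esub> l \<odot>\<^bsub>M\<^esub> (s [^]\<^bsub>R\<^esub> l \<odot>\<^bsub>M\<^esub> (t [^]\<^bsub>R\<^esub> k \<odot>\<^bsub>M\<^esub> v)))"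
      if "v \<in> carrier M" for v
      using s t that by (simp add: M.smult_pow_mult M.smult_pow_add M.smult_left_commute)
    then show ?thesis using x l by metis
  qed
  ultimately show ?thesis
    unfolding is_localization_at_def using module_hom_compose[OF \<phi> \<psi>] by blast
qed

text \<open>The element \<open>z\<close> is the fraction in \<open>L'\<close> with the same numerator and denominator as \<open>y\<close>. It
  exists since \<open>s\<close> is surjective on \<open>L'\<close>. Two choices of numerator and denominator for \<open>y\<close> agree in
  \<open>M\<close> after multiplication by a power of \<open>s\<close>, and powers of \<open>s\<close> cancel in \<open>L'\<close>.\<close>

lemma localization_at_fraction_unique:
  assumes loc: "is_localization_at R s M L \<phi>" and loc': "is_localization_at R s M L' \<phi>'"
    and M: "module R M" and L: "module R L" and L': "module R L'" and s: "s \<in> carrier R"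
    and y: "y \<in> carrier L"
  shows "\<exists>!z. z \<in> carrier L' \<and>
    (\<exists>k::nat. \<exists>x\<in>carrier M. s [^]\<^bsub>R\<^esub> k \<odot>\<^bsub>L\<^esub> y = \<phi> x \<and> s [^]\<^bsub>R\<^esub> k \<odot>\<^bsub>L'\<^esub> z = \<phi>' x)"
proof -
  interpret M: module R M by (rule M)
  interpret L: module R L by (rule L)
  interpret L': module R L' by (rule L')
  have \<phi>: "\<phi> \<in> module_hom R M L"
    using loc by (auto simp: is_localization_at_def)
  have \<phi>': "\<phi>' \<in> module_hom R M L'"
    and bij': "bij_betw (\<lambda>y. s \<odot>\<^bsub>L'\<^esub> y) (carrier L') (carrier L')"
    using loc' by (auto simp: is_localization_at_def)
  note lin = module_hom_smult[OF \<phi>] module_hom_smult[OF \<phi>']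
  obtain k :: nat and x where x: "x \<in> carrier M" "s [^]\<^bsub>R\<^esub> k \<odot>\<^bsub>L\<^esub> y = \<phi> x"
    using loc y by (auto simp: is_localization_at_def)
  obtain z where z: "z \<in> carrier L'" "s [^]\<^bsub>R\<^esub> k \<odot>\<^bsub>L'\<^esub> z = \<phi>' x"
    using L'.bij_betw_smult_pow[OF s bij', of k] module_hom_closed[OF \<phi>' x(1)]
    by (auto simp: bij_betw_def) (metis imageE)
  have "z' = z" if z': "z' \<in> carrier L'" and x': "x' \<in> carrier M"
    "s [^]\<^bsub>R\<^esub> l \<odot>\<^bsub>L\<^esub> y = \<phi> x'" "s [^]\<^bsub>R\<^esub> l \<odot>\<^bsub>L'\<^esub> z' = \<phi>' x'" for z' x' and l :: nat
  proof -
    have "\<phi> (s [^]\<^bsub>R\<^esub> k \<odot>\<^bsub>M\<^esub> x') = \<phi> (s [^]\<^bsub>R\<^esub> l \<odot>\<^bsub>M\<^esub> x)"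
      using x x' y s by (simp add: lin L.smult_left_commute flip: x(2) x'(2))
    then obtain m :: nat where m: "s [^]\<^bsub>R\<^esub> m \<odot>\<^bsub>M\<^esub> (s [^]\<^bsub>R\<^esub> k \<odot>\<^bsub>M\<^esub> x') =
      s [^]\<^bsub>R\<^esub> m \<odot>\<^bsub>M\<^esub> (s [^]\<^bsub>R\<^esub> l \<odot>\<^bsub>M\<^esub> x)"
      using x x' s by (auto elim: is_localization_at_eqD[OF loc, rotated 2])
    have "s [^]\<^bsub>R\<^esub> (m + k + l) \<odot>\<^bsub>L'\<^esub> z' = \<phi>' (s [^]\<^bsub>R\<^esub> m \<odot>\<^bsub>M\<^esub> (s [^]\<^bsub>R\<^esub> k \<odot>\<^bsub>M\<^esub> x'))"
      using z' x' s module_hom_closed[OF \<phi>'] by (simp add: lin L'.smult_pow_add)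
    also have "\<dots> = s [^]\<^bsub>R\<^esub> (m + k + l) \<odot>\<^bsub>L'\<^esub> z"
      unfolding m using z x s
      by (simp add: lin L'.smult_pow_add L'.smult_left_commute flip: z(2))
    finally show ?thesis
      by (rule L'.smult_pow_cancel[OF s bij' z' z(1)])
  qed
  then show ?thesis using x z by blast
qed

lemma is_localization_at_unique:
  assumes loc: "is_localization_at R s M L \<phi>" and loc': "is_localization_at R s M L' \<phi>'"
    and M: "module R M" and L: "module R L" and L': "module R L'" and s: "s \<in> carrier R"
  shows "isomorphic_over R M L \<phi> L' \<phi>'"
proof -
  interpret M: module R M by (rule M)
  interpret L: module R L by (rule L)
  interpret L': module R L' by (rule L')
  have \<phi>: "\<phi> \<in> module_hom R M L" and \<phi>': "\<phi>' \<in> module_hom R M L'"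
    using loc loc' by (auto simp: is_localization_at_def)
  \<comment> \<open>The relation of having a common expression as a fraction is symmetric in \<open>L\<close> and \<open>L'\<close>.
    Hence one uniqueness lemma, used in both directions, makes it the graph of a bijection.\<close>
  define T where "T y z \<longleftrightarrow> (\<exists>k::nat. \<exists>x\<in>carrier M. s [^]\<^bsub>R\<^esub> k \<odot>\<^bsub>L\<^esub> y = \<phi> x \<and>
    s [^]\<^bsub>R\<^esub> k \<odot>\<^bsub>L'\<^esub> z = \<phi>' x)" for y z
  have ex: "\<exists>!z. z \<in> carrier L' \<and> T y z" if "y \<in> carrier L" for y
    unfolding T_def by (rule localization_at_fraction_unique[OF loc loc' M L L' s that])
  have T_flip: "T y z \<longleftrightarrow> (\<exists>k::nat. \<exists>x\<in>carrier M. s [^]\<^bsub>R\<^esub> k \<odot>\<^bsub>L'\<^esub> z = \<phi>' x \<and>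
    s [^]\<^bsub>R\<^esub> k \<odot>\<^bsub>L\<^esub> y = \<phi> x)" for y z
    unfolding T_def by blast
  have ex': "\<exists>!y. y \<in> carrier L \<and> T y z" if "z \<in> carrier L'" for z
    unfolding T_flip by (rule localization_at_fraction_unique[OF loc' loc M L' L s that])
  define h where "h y = (THE z. z \<in> carrier L' \<and> T y z)" for y
  have h: "h y \<in> carrier L'" "T y (h y)" if "y \<in> carrier L" for y
    using theI'[OF ex[OF that]] by (auto simp: h_def)
  have h_eq: "h y = z" if "y \<in> carrier L" "z \<in> carrier L'" "T y z" for y z
    using ex h that by blast
  have "h (\<phi> x) = \<phi>' x" if x: "x \<in> carrier M" for x
  proof (rule h_eq)
    show "T (\<phi> x) (\<phi>' x)"
      unfolding T_def using x module_hom_closed[OF \<phi> x] module_hom_closed[OF \<phi>' x]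
      by (intro exI[of _ 0] bexI[of _ x]) simp_all
  qed (use x module_hom_closed[OF \<phi>] module_hom_closed[OF \<phi>'] in auto)
  moreover have "h (y \<oplus>\<^bsub>L\<^esub> y') = h y \<oplus>\<^bsub>L'\<^esub> h y'" if y: "y \<in> carrier L" "y' \<in> carrier L" for y y'
  proof (rule h_eq)
    obtain k l :: nat and x x' where x: "x \<in> carrier M" "x' \<in> carrier M"
      "s [^]\<^bsub>R\<^esub> k \<odot>\<^bsub>L\<^esub> y = \<phi> x" "s [^]\<^bsub>R\<^esub> k \<odot>\<^bsub>L'\<^esub> h y = \<phi>' x"
      "s [^]\<^bsub>R\<^esub> l \<odot>\<^bsub>L\<^esub> y' = \<phi> x'" "s [^]\<^bsub>R\<^esub> l \<odot>\<^bsub>L'\<^esub> h y' = \<phi>' x'"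
      using h(2)[OF y(1)] h(2)[OF y(2)] unfolding T_def by blast
    let ?x = "s [^]\<^bsub>R\<^esub> l \<odot>\<^bsub>M\<^esub> x \<oplus>\<^bsub>M\<^esub> s [^]\<^bsub>R\<^esub> k \<odot>\<^bsub>M\<^esub> x'"
    have "s [^]\<^bsub>R\<^esub> (k + l) \<odot>\<^bsub>L\<^esub> (y \<oplus>\<^bsub>L\<^esub> y') = \<phi> ?x"
      using x(1,2) y s
      by (simp add: module_hom_add[OF \<phi>] module_hom_smult[OF \<phi>] L.smult_pow_add
          L.smult_r_distr L.smult_left_commute flip: x(3,5))
    moreover have "s [^]\<^bsub>R\<^esub> (k + l) \<odot>\<^bsub>L'\<^esub> (h y \<oplus>\<^bsub>L'\<^esub> h y') = \<phi>' ?x"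
      using x(1,2) h y s
      by (simp add: module_hom_add[OF \<phi>'] module_hom_smult[OF \<phi>'] L'.smult_pow_add
          L'.smult_r_distr L'.smult_left_commute flip: x(4,6))
    ultimately show "T (y \<oplus>\<^bsub>L\<^esub> y') (h y \<oplus>\<^bsub>L'\<^esub> h y')"
      unfolding T_def using x(1,2) s by (intro exI bexI[of _ ?x]) auto
  qed (use y h in auto)
  moreover have "h (a \<odot>\<^bsub>L\<^esub> y) = a \<odot>\<^bsub>L'\<^esub> h y" if a: "a \<in> carrier R" and y: "y \<in> carrier L" for a y
  proof (rule h_eq)
    obtain k :: nat and x where x: "x \<in> carrier M"
      "s [^]\<^bsub>R\<^esub> k \<odot>\<^bsub>L\<^esub> y = \<phi> x" "s [^]\<^bsub>R\<^esub> k \<odot>\<^bsub>L'\<^esub> h y = \<phi>' x"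
      using h(2)[OF y] unfolding T_def by blast
    then have "s [^]\<^bsub>R\<^esub> k \<odot>\<^bsub>L\<^esub> (a \<odot>\<^bsub>L\<^esub> y) = \<phi> (a \<odot>\<^bsub>M\<^esub> x)"
      "s [^]\<^bsub>R\<^esub> k \<odot>\<^bsub>L'\<^esub> (a \<odot>\<^bsub>L'\<^esub> h y) = \<phi>' (a \<odot>\<^bsub>M\<^esub> x)"
      using a y s h by (simp_all add: module_hom_smult[OF \<phi>] module_hom_smult[OF \<phi>']
          L.smult_left_commute[of _ a] L'.smult_left_commute[of _ a])
    then show "T (a \<odot>\<^bsub>L\<^esub> y) (a \<odot>\<^bsub>L'\<^esub> h y)"
      unfolding T_def using x(1) a by blast
  qed (use a y h in auto)
  moreover have "bij_betw h (carrier L) (carrier L')"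
    unfolding bij_betw_def
  proof
    show "inj_on h (carrier L)"
      by (rule inj_onI) (metis ex' h)
    show "h ` carrier L = carrier L'"
      using ex' h h_eq by (auto simp: image_iff) metis
  qed
  ultimately have "h \<in> module_iso R L L'" "\<forall>x\<in>carrier M. h (\<phi> x) = \<phi>' x"
    by (auto simp: module_iso_def module_hom_def h)
  then show ?thesis
    by (auto simp: isomorphic_over_def)
qed


section \<open>Overlaps\<close>

text \<open>The representatives of \<open>x/(st)\<^sup>k\<close> give a single element of \<open>(M\<^sub>s)\<^sub>t\<close>: \<open>M \<rightarrow> (M\<^sub>s)\<^sub>t\<close> is a
  localization at \<open>st\<close>, so an element of \<open>(M\<^sub>s)\<^sub>t\<close> is determined by its product with a power of
  \<open>st\<close>, and \<open>(st)\<^sup>l\<close> takes \<open>(y/s\<^sup>l)/t\<^sup>l\<close> to the image of \<open>y\<close>.\<close>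

lemma iterated_loc_frac:
  fixes R (structure)
  assumes M: "module R M" and s: "s \<in> carrier R" and t: "t \<in> carrier R" and x: "x \<in> carrier M"
  shows "iterated_loc R M s t (frac R (powers R (s \<otimes> t)) M x ((s \<otimes> t) [^] (k::nat))) =
    frac R (powers R t) (localization_at R M s) (frac R (powers R s) M x (s [^] k)) (t [^] k)"
proof -
  let ?Ms = "localization_at R M s"
  let ?Mst = "localization_at R ?Ms t"
  let ?fs = "frac R (powers R s) M"
  let ?ft = "frac R (powers R t) ?Ms"
  let ?fst = "frac R (powers R (s \<otimes> t)) M"
  interpret module R M by (rule M)
  have st: "s \<otimes> t \<in> carrier R" using s t by simp
  interpret s: fractions R M "powers R s" by (rule fractions_powers[OF M s])
  interpret st: fractions R M "powers R (s \<otimes> t)" by (rule fractions_powers[OF M st])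
  interpret Ms: module R ?Ms by (rule s.module_localization)
  interpret t: fractions R ?Ms "powers R t" by (rule fractions_powers[OF Ms.module_axioms t])
  interpret Mst: module R ?Mst by (rule t.module_localization)
  let ?\<phi> = "\<lambda>x. ?ft (?fs x \<one>) \<one>"
  have loc: "is_localization_at R (s \<otimes> t) M ?Mst ?\<phi>"
    by (rule is_localization_at_trans[OF localization_at_is_localization_at[OF M s]
          localization_at_is_localization_at[OF Ms.module_axioms t] module_axioms Ms.module_axioms
          Mst.module_axioms s t])
  then have hom: "?\<phi> \<in> module_hom R M ?Mst"
    and bij: "bij_betw (\<lambda>y. (s \<otimes> t) \<odot>\<^bsub>?Mst\<^esub> y) (carrier ?Mst) (carrier ?Mst)"
    by (auto simp: is_localization_at_def)
  note mem = pow_in_powers[of R s] pow_in_powers[of R t] pow_in_powers[of R "s \<otimes> t"]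
  have clear: "(s \<otimes> t) [^] l \<odot>\<^bsub>?Mst\<^esub> ?ft (?fs y (s [^] l)) (t [^] l) = ?\<phi> y"
    if y: "y \<in> carrier M" for y and l :: nat
  proof -
    have fs: "?fs y (s [^] l) \<in> carrier ?Ms"
      using y mem by (simp add: s.frac_in_localization)
    have "(s \<otimes> t) [^] l \<odot>\<^bsub>?Mst\<^esub> ?ft (?fs y (s [^] l)) (t [^] l)
      = s [^] l \<odot>\<^bsub>?Mst\<^esub> (t [^] l \<odot>\<^bsub>?Mst\<^esub> ?ft (?fs y (s [^] l)) (t [^] l))"
      using s t fs mem by (intro Mst.smult_pow_mult t.frac_in_localization)
    also have "t [^] l \<odot>\<^bsub>?Mst\<^esub> ?ft (?fs y (s [^] l)) (t [^] l) = ?ft (?fs y (s [^] l)) \<one>"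
      using t.smult_denominator_frac[of "?fs y (s [^] l)" "t [^] l" \<one>] t fs mem
        t.denominators.one_closed by simp
    also have "s [^] l \<odot>\<^bsub>?Mst\<^esub> ?ft (?fs y (s [^] l)) \<one> = ?ft (s [^] l \<odot>\<^bsub>?Ms\<^esub> ?fs y (s [^] l)) \<one>"
      using s fs t.denominators.one_closed by (intro t.smult_frac) auto
    also have "s [^] l \<odot>\<^bsub>?Ms\<^esub> ?fs y (s [^] l) = ?fs y \<one>"
      using s.smult_denominator_frac[of y "s [^] l" \<one>] s y mem s.denominators.one_closed by simp
    finally show ?thesis .
  qed
  have unique: "?ft (?fs y (s [^] l)) (t [^] l) = ?ft (?fs x (s [^] k)) (t [^] k)"
    if rep: "(y, (s \<otimes> t) [^] l) \<in> ?fst x ((s \<otimes> t) [^] k)" for y and l :: nat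
  proof -
    have y: "y \<in> carrier M" and eq: "?fst y ((s \<otimes> t) [^] l) = ?fst x ((s \<otimes> t) [^] k)"
      using rep x mem(3) by (simp_all add: st.mem_frac_iff)
    let ?z = "?ft (?fs y (s [^] l)) (t [^] l)" and ?z' = "?ft (?fs x (s [^] k)) (t [^] k)"
    have z: "?z \<in> carrier ?Mst" "?z' \<in> carrier ?Mst"
      using x y mem by (simp_all add: t.frac_in_localization s.frac_in_localization)
    obtain m :: nat where m: "(s \<otimes> t) [^] m \<odot>\<^bsub>M\<^esub> ((s \<otimes> t) [^] k \<odot>\<^bsub>M\<^esub> y) =
      (s \<otimes> t) [^] m \<odot>\<^bsub>M\<^esub> ((s \<otimes> t) [^] l \<odot>\<^bsub>M\<^esub> x)"
      using eq x y mem by (auto simp: st.frac_eq_iff) (auto simp: powers_def)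
    have "(s \<otimes> t) [^] (m + k + l) \<odot>\<^bsub>?Mst\<^esub> ?z
      = ?\<phi> ((s \<otimes> t) [^] m \<odot>\<^bsub>M\<^esub> ((s \<otimes> t) [^] k \<odot>\<^bsub>M\<^esub> y))"
      using st z y module_hom_closed[OF hom]
      by (simp add: Mst.smult_pow_add clear module_hom_smult[OF hom])
    also have "\<dots> = (s \<otimes> t) [^] (m + l + k) \<odot>\<^bsub>?Mst\<^esub> ?z'"
      unfolding m using st z x module_hom_closed[OF hom]
      by (simp add: Mst.smult_pow_add clear module_hom_smult[OF hom])
    finally have "(s \<otimes> t) [^] (m + k + l) \<odot>\<^bsub>?Mst\<^esub> ?z = (s \<otimes> t) [^] (m + k + l) \<odot>\<^bsub>?Mst\<^esub> ?z'"
      by (simp add: ac_simps)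
    then show ?thesis
      by (rule Mst.smult_pow_cancel[OF st bij z])
  qed
  have "{?ft (?fs y (s [^] l)) (t [^] l) | y (l::nat). (y, (s \<otimes> t) [^] l) \<in> ?fst x ((s \<otimes> t) [^] k)}
    = {?ft (?fs x (s [^] k)) (t [^] k)}" (is "?A = _")
  proof
    show "?A \<subseteq> {?ft (?fs x (s [^] k)) (t [^] k)}"
      using unique by blast
    show "{?ft (?fs x (s [^] k)) (t [^] k)} \<subseteq> ?A"
    proof -
      have "(x, (s \<otimes> t) [^] k) \<in> ?fst x ((s \<otimes> t) [^] k)"
        using x mem(3) by (simp add: st.mem_frac_iff)
      then show ?thesis by blast
    qed
  qed
  then show ?thesis
    by (simp add: iterated_loc_def)
qed

text \<open>The map \<open>\<phi>\<close> is the composite \<open>H \<rightarrow> H\<^sub>s \<cong> E \<rightarrow> E\<^sub>t\<close>. The last two conclusions determine the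
  overlap map on \<open>M\<^bsub>st\<^esub>\<close> from \<open>\<phi>\<close> and \<open>\<iota>\<close> alone, since \<open>st\<close> acts bijectively on \<open>E\<^sub>t\<close>; what
  remains of \<open>e\<close> and of the iterated fractions is hidden in \<open>\<phi>\<close>.\<close>

lemma overlap_map_localization:
  assumes M: "module R M" and H: "module R H" and E: "module R E"
    and s: "s \<in> carrier R" and t: "t \<in> carrier R"
    and \<iota>: "\<iota> \<in> module_hom R M H"
    and over: "isomorphic_over R (localization_at R M s)
      (localization_at R H s) (loc_map R (powers R s) H \<iota>) E e"
  obtains \<phi> where "is_localization_at R (s \<otimes>\<^bsub>R\<^esub> t) H (localization_at R E t) \<phi>"
    and "\<And>x k. x \<in> carrier M \<Longrightarrow>
      overlap_map R M s t E e (frac R (powers R (s \<otimes>\<^bsub>R\<^esub> t)) M x ((s \<otimes>\<^bsub>R\<^esub> t) [^]\<^bsub>R\<^esub> (k::nat)))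
        \<in> carrier (localization_at R E t)"
    and "\<And>x k. x \<in> carrier M \<Longrightarrow>
      (s \<otimes>\<^bsub>R\<^esub> t) [^]\<^bsub>R\<^esub> k \<odot>\<^bsub>localization_at R E t\<^esub>
        overlap_map R M s t E e (frac R (powers R (s \<otimes>\<^bsub>R\<^esub> t)) M x ((s \<otimes>\<^bsub>R\<^esub> t) [^]\<^bsub>R\<^esub> (k::nat)))
        = \<phi> (\<iota> x)"
proof -
  interpret M: module R M by (rule M)
  interpret H: module R H by (rule H)
  interpret E: module R E by (rule E)
  interpret Ms: fractions R M "powers R s" by (rule fractions_powers[OF M.module_axioms s])
  interpret Hs: fractions R H "powers R s" by (rule fractions_powers[OF H.module_axioms s])
  interpret Et: fractions R E "powers R t" by (rule fractions_powers[OF E.module_axioms t])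
  interpret LM: module R "localization_at R M s" by (rule Ms.module_localization)
  interpret LH: module R "localization_at R H s" by (rule Hs.module_localization)
  interpret LE: module R "localization_at R E t" by (rule Et.module_localization)
  interpret Mst: fractions R "localization_at R M s" "powers R t" by (rule fractions_powers[OF LM.module_axioms t])
  let ?fM = "frac R (powers R s) M" and ?fH = "frac R (powers R s) H"
    and ?fE = "frac R (powers R t) E"
  obtain h where h: "h \<in> module_iso R (localization_at R H s) E"
    and over_h: "\<forall>X\<in>carrier (localization_at R M s). h (loc_map R (powers R s) H \<iota> X) = e X"
    using over by (auto simp: isomorphic_over_def)
  have hom: "h \<in> module_hom R (localization_at R H s) E"
    by (rule module_iso_hom[OF h])
  have e_frac: "e (?fM x u) = h (?fH (\<iota> x) u)" if "x \<in> carrier M" "u \<in> powers R s" for x u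
    using that bspec[OF over_h Ms.frac_in_localization[OF that]]
    by (simp add: Ms.loc_map_frac[OF Hs.fractions_axioms \<iota>])
  have fH: "?fH (\<iota> x) u \<in> carrier (localization_at R H s)"
    if "x \<in> carrier M" "u \<in> powers R s" for x u
    using that by (simp add: Hs.frac_in_localization module_hom_closed[OF \<iota>])
  \<comment> \<open>On the carrier of \<open>M\<^sub>s\<close>, \<open>e\<close> is the composite of \<open>M\<^sub>s \<rightarrow> H\<^sub>s\<close> with \<open>h\<close>.\<close>
  have e: "e \<in> module_hom R (localization_at R M s) E"
  proof -
    have "e (X \<oplus>\<^bsub>localization_at R M s\<^esub> Y) = e X \<oplus>\<^bsub>E\<^esub> e Y"
      if "X \<in> carrier (localization_at R M s)" "Y \<in> carrier (localization_at R M s)" for X Y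
      by (rule Ms.common_denominator[OF that])
        (simp add: Ms.add_frac_same_denominator e_frac module_hom_add[OF \<iota>]
          module_hom_closed[OF \<iota>] fH flip: Hs.add_frac_same_denominator module_hom_add[OF hom])
    moreover have "e (a \<odot>\<^bsub>localization_at R M s\<^esub> X) = a \<odot>\<^bsub>E\<^esub> e X"
      if a: "a \<in> carrier R" and X: "X \<in> carrier (localization_at R M s)" for a X
      by (rule Ms.localization_cases[OF X])
        (simp add: a Ms.smult_frac e_frac module_hom_smult[OF \<iota>]
          module_hom_closed[OF \<iota>] fH flip: Hs.smult_frac module_hom_smult[OF hom])
    moreover have "e X \<in> carrier E" if "X \<in> carrier (localization_at R M s)" for X
      by (rule Ms.localization_cases[OF that]) (simp add: e_frac fH module_hom_closed[OF hom])
    ultimately show ?thesis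
      by (auto simp: module_hom_def)
  qed
  let ?\<phi> = "\<lambda>y. ?fE (h (?fH y \<one>\<^bsub>R\<^esub>)) \<one>\<^bsub>R\<^esub>"
  note mem = pow_in_powers[of R s] pow_in_powers[of R t]
  have ov: "overlap_map R M s t E e (frac R (powers R (s \<otimes>\<^bsub>R\<^esub> t)) M x ((s \<otimes>\<^bsub>R\<^esub> t) [^]\<^bsub>R\<^esub> k)) =
    ?fE (h (?fH (\<iota> x) (s [^]\<^bsub>R\<^esub> k))) (t [^]\<^bsub>R\<^esub> k)" if x: "x \<in> carrier M" for x and k :: nat
    using x mem unfolding overlap_map_def
    by (simp add: iterated_loc_frac[OF M s t] Mst.loc_map_frac[OF Et.fractions_axioms e]
        Ms.frac_in_localization e_frac)
  show ?thesis
  proof (rule that[of ?\<phi>])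
    have "is_localization_at R s H E (\<lambda>y. h (?fH y \<one>\<^bsub>R\<^esub>))"
      by (rule is_localization_at_compose_iso[OF localization_at_is_localization_at[OF H.module_axioms s] h
            LH.module_axioms s])
    then show "is_localization_at R (s \<otimes>\<^bsub>R\<^esub> t) H (localization_at R E t) ?\<phi>"
      by (rule is_localization_at_trans[OF _ localization_at_is_localization_at[OF E.module_axioms t]
            H E LE.module_axioms s t])
  next
    fix x and k :: nat
    assume x: "x \<in> carrier M"
    let ?y = "h (?fH (\<iota> x) (s [^]\<^bsub>R\<^esub> k))"
    have y: "?y \<in> carrier E"
      using x mem by (simp add: module_hom_closed[OF hom] fH)
    show "overlap_map R M s t E e (frac R (powers R (s \<otimes>\<^bsub>R\<^esub> t)) M x ((s \<otimes>\<^bsub>R\<^esub> t) [^]\<^bsub>R\<^esub> k))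
        \<in> carrier (localization_at R E t)"
      using x y mem by (simp add: ov Et.frac_in_localization)
    have "s [^]\<^bsub>R\<^esub> k \<odot>\<^bsub>localization_at R H s\<^esub> ?fH (\<iota> x) (s [^]\<^bsub>R\<^esub> k) = ?fH (\<iota> x) \<one>\<^bsub>R\<^esub>"
      using Hs.smult_denominator_frac[of "\<iota> x" "s [^]\<^bsub>R\<^esub> k" "\<one>\<^bsub>R\<^esub>"] s mem
        Ms.denominators.one_closed module_hom_closed[OF \<iota> x] by simp
    then have s_y: "s [^]\<^bsub>R\<^esub> k \<odot>\<^bsub>E\<^esub> ?y = h (?fH (\<iota> x) \<one>\<^bsub>R\<^esub>)"
      using s x mem by (simp add: fH flip: module_hom_smult[OF hom])
    have "(s \<otimes>\<^bsub>R\<^esub> t) [^]\<^bsub>R\<^esub> k \<odot>\<^bsub>localization_at R E t\<^esub> ?fE ?y (t [^]\<^bsub>R\<^esub> k)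
      = s [^]\<^bsub>R\<^esub> k \<odot>\<^bsub>localization_at R E t\<^esub> (t [^]\<^bsub>R\<^esub> k \<odot>\<^bsub>localization_at R E t\<^esub> ?fE ?y (t [^]\<^bsub>R\<^esub> k))"
      using s t y mem by (intro LE.smult_pow_mult Et.frac_in_localization)
    also have "t [^]\<^bsub>R\<^esub> k \<odot>\<^bsub>localization_at R E t\<^esub> ?fE ?y (t [^]\<^bsub>R\<^esub> k) = ?fE ?y \<one>\<^bsub>R\<^esub>"
      using Et.smult_denominator_frac[of ?y "t [^]\<^bsub>R\<^esub> k" "\<one>\<^bsub>R\<^esub>"] t y mem
        Et.denominators.one_closed by simp
    also have "s [^]\<^bsub>R\<^esub> k \<odot>\<^bsub>localization_at R E t\<^esub> ?fE ?y \<one>\<^bsub>R\<^esub> = ?fE (s [^]\<^bsub>R\<^esub> k \<odot>\<^bsub>E\<^esub> ?y) \<one>\<^bsub>R\<^esub>"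
      using s y Et.denominators.one_closed by (intro Et.smult_frac) auto
    finally show "(s \<otimes>\<^bsub>R\<^esub> t) [^]\<^bsub>R\<^esub> k \<odot>\<^bsub>localization_at R E t\<^esub>
        overlap_map R M s t E e (frac R (powers R (s \<otimes>\<^bsub>R\<^esub> t)) M x ((s \<otimes>\<^bsub>R\<^esub> t) [^]\<^bsub>R\<^esub> k)) = ?\<phi> (\<iota> x)"
      by (simp only: ov[OF x] s_y)
  qed
qed

text \<open>\<open>E\<^sub>t\<close> and \<open>E'\<^sub>s\<close> are localizations of \<open>H\<close> at the same element \<open>st = ts\<close>, and both overlap maps
  are induced by \<open>\<iota>\<close>. The isomorphism between the localizations therefore carries one overlap map to
  the other.\<close>

lemma isomorphic_overlaps_of_global_module:
  assumes M: "module R M" and H: "module R H" and E: "module R E" and E': "module R E'"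
    and s: "s \<in> carrier R" and t: "t \<in> carrier R"
    and \<iota>: "\<iota> \<in> module_hom R M H"
    and over: "isomorphic_over R (localization_at R M s)
      (localization_at R H s) (loc_map R (powers R s) H \<iota>) E e"
    and over': "isomorphic_over R (localization_at R M t)
      (localization_at R H t) (loc_map R (powers R t) H \<iota>) E' e'"
  shows "isomorphic_over R (localization_at R M (s \<otimes>\<^bsub>R\<^esub> t))
      (localization_at R E t) (overlap_map R M s t E e)
      (localization_at R E' s) (overlap_map R M t s E' e')"
proof -
  interpret M: module R M by (rule M)
  interpret E: module R E by (rule E)
  interpret E': module R E' by (rule E')
  let ?L = "localization_at R E t" and ?L' = "localization_at R E' s"
  have L: "module R ?L"
    by (rule fractions.module_localization[OF fractions_powers[OF E.module_axioms t]])
  have L': "module R ?L'"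
    by (rule fractions.module_localization[OF fractions_powers[OF E'.module_axioms s]])
  interpret L': module R ?L' by (rule L')
  have comm: "t \<otimes>\<^bsub>R\<^esub> s = s \<otimes>\<^bsub>R\<^esub> t" by (rule M.m_comm[OF t s])
  have st: "s \<otimes>\<^bsub>R\<^esub> t \<in> carrier R" using s t by simp
  interpret st: fractions R M "powers R (s \<otimes>\<^bsub>R\<^esub> t)" by (rule fractions_powers[OF M.module_axioms st])
  let ?X = "\<lambda>x k. frac R (powers R (s \<otimes>\<^bsub>R\<^esub> t)) M x ((s \<otimes>\<^bsub>R\<^esub> t) [^]\<^bsub>R\<^esub> (k::nat))"
  obtain \<phi> where \<phi>: "is_localization_at R (s \<otimes>\<^bsub>R\<^esub> t) H ?L \<phi>"
    "\<And>x k. x \<in> carrier M \<Longrightarrow> overlap_map R M s t E e (?X x k) \<in> carrier ?L"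
    "\<And>x k. x \<in> carrier M \<Longrightarrow>
      (s \<otimes>\<^bsub>R\<^esub> t) [^]\<^bsub>R\<^esub> k \<odot>\<^bsub>?L\<^esub> overlap_map R M s t E e (?X x k) = \<phi> (\<iota> x)"
    using overlap_map_localization[OF M H E s t \<iota> over] by blast
  obtain \<phi>' where \<phi>': "is_localization_at R (s \<otimes>\<^bsub>R\<^esub> t) H ?L' \<phi>'"
    "\<And>x k. x \<in> carrier M \<Longrightarrow> overlap_map R M t s E' e' (?X x k) \<in> carrier ?L'"
    "\<And>x k. x \<in> carrier M \<Longrightarrow>
      (s \<otimes>\<^bsub>R\<^esub> t) [^]\<^bsub>R\<^esub> k \<odot>\<^bsub>?L'\<^esub> overlap_map R M t s E' e' (?X x k) = \<phi>' (\<iota> x)"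
    using overlap_map_localization[OF M H E' t s \<iota> over'] unfolding comm by blast
  have bij: "bij_betw (\<lambda>y. (s \<otimes>\<^bsub>R\<^esub> t) \<odot>\<^bsub>?L'\<^esub> y) (carrier ?L') (carrier ?L')"
    using \<phi>'(1) by (simp add: is_localization_at_def)
  obtain h where h: "h \<in> module_iso R ?L ?L'" "\<forall>y\<in>carrier H. h (\<phi> y) = \<phi>' y"
    using is_localization_at_unique[OF \<phi>(1) \<phi>'(1) H L L' st] by (auto simp: isomorphic_over_def)
  note hom = module_iso_hom[OF h(1)]
  have "h (overlap_map R M s t E e X) = overlap_map R M t s E' e' X"
    if X: "X \<in> carrier (localization_at R M (s \<otimes>\<^bsub>R\<^esub> t))" for X
  proof -
    obtain x u where x: "x \<in> carrier M" and "u \<in> powers R (s \<otimes>\<^bsub>R\<^esub> t)"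
      and "X = frac R (powers R (s \<otimes>\<^bsub>R\<^esub> t)) M x u"
      using X by (rule st.localization_cases)
    then obtain k where X: "X = ?X x k"
      by (auto simp: powers_def)
    have "(s \<otimes>\<^bsub>R\<^esub> t) [^]\<^bsub>R\<^esub> k \<odot>\<^bsub>?L'\<^esub> h (overlap_map R M s t E e X) = h (\<phi> (\<iota> x))"
      using st x by (simp add: X \<phi> flip: module_hom_smult[OF hom])
    also have "\<dots> = (s \<otimes>\<^bsub>R\<^esub> t) [^]\<^bsub>R\<^esub> k \<odot>\<^bsub>?L'\<^esub> overlap_map R M t s E' e' X"
      using h(2) x by (simp add: X \<phi>' module_hom_closed[OF \<iota>])
    finally show ?thesis
      by (rule L'.smult_pow_cancel[OF st bij, rotated 2])
        (use x in \<open>simp_all add: X \<phi> \<phi>' module_hom_closed[OF hom]\<close>)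
  qed
  then show ?thesis
    using h(1) by (auto simp: isomorphic_over_def)
qed

section \<open>Incompatible local hulls\<close>

theorem theorem7p12:
  fixes R :: "('a, 'r) ring_scheme"
    and \<C> :: "('a, 'u) module set"
    and M :: "('a, 'b) module"
    and n :: nat
    and s :: "nat \<Rightarrow> 'a"
    and E :: "nat \<Rightarrow> ('a, 'u) module"
    and e :: "nat \<Rightarrow> ('b \<times> 'a) set \<Rightarrow> 'u"
  assumes "cring R"
    and "hull_class R \<C>"
    and "module R M"
    and "\<forall>i\<in>{1..n}. s i \<in> carrier R"
    and "Supp R M \<subseteq> (\<Union>i\<in>{1..n}. basic_open R (s i))"
    and "\<forall>i\<in>{1..n}. is_hull R \<C> (localization_at R M (s i)) (E i) (e i)"
    and "\<not> patch_compatible R M {1..n} s E e"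
  shows "\<not> (\<exists>H \<iota>. is_hull R \<C> M H \<iota> \<and>
           (\<forall>i\<in>{1..n}. isomorphic_over R (localization_at R M (s i))
              (localization_at R H (s i)) (loc_map R (powers R (s i)) H \<iota>) (E i) (e i)))"
proof
  assume "\<exists>H \<iota>. is_hull R \<C> M H \<iota> \<and>
           (\<forall>i\<in>{1..n}. isomorphic_over R (localization_at R M (s i))
              (localization_at R H (s i)) (loc_map R (powers R (s i)) H \<iota>) (E i) (e i))"
  then obtain H \<iota> where hull: "is_hull R \<C> M H \<iota>"
    and over: "\<And>i. i \<in> {1..n} \<Longrightarrow> isomorphic_over R (localization_at R M (s i))
      (localization_at R H (s i)) (loc_map R (powers R (s i)) H \<iota>) (E i) (e i)"
    by blast
  have H: "module R H" and \<iota>: "\<iota> \<in> module_hom R M H"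
    using hull assms(2)
    by (auto simp: is_hull_def is_preenvelope_def module_mono_def hull_class_def)
  have E: "module R (E i)" if "i \<in> {1..n}" for i
    using that assms(2,6) by (auto simp: is_hull_def is_preenvelope_def hull_class_def)
  have "patch_compatible R M {1..n} s E e"
    unfolding patch_compatible_def using assms(4)
    by (intro ballI isomorphic_overlaps_of_global_module[OF assms(3) H E E _ _ \<iota> over over]) auto
  then show False
    using assms(7) by contradiction
qed

end
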